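(* Let $d\in\{1,2,3,7,11,19,43,67,163\}$. The set $\mathbf{Bad}_d$ is absolute winning in $\mathbb C$, and for all $(p,q)\in\mathcal O_d^2$ with $q\ne0$ and all $0<r\le\frac{1}{2|q|^2}$ the set $\mathbf{Bad}_d\cap S(p/q,r)$ is absolute winning in $S(p/q,r)$, where $S(p/q,r)=\partial B(p/q,r)$ is the Euclidean circle in $\mathbb C$ of center $p/q$ and radius $r$. Moreover, there exist $t_0$ and $t_1$ such that $[t_0,\infty)\subset\mathcal S_d$ and positive constants $k_0,k_u>0$ such that for all $t\ge t_0$ $$1-\frac{k_0}{t\cdot e^{t/2}}\ \le\ \mathfrak D^0_d(t)\ \le\ 2-\frac{k_u}{t\cdot e^{4t}},$$ and for all $t\in\mathcal S_d$ with $t\ge t_1$ $$2-\frac{k_0}{t\cdot e^{t}}\ \le\ \mathfrak D_d(t)\ \le\ 2-\frac{k_u}{t\cdot e^{4t}}.$$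
   Context: $\mathcal O_d$ is the ring of integers of the imaginary quadratic number field $\mathbb Q(i\sqrt d)$ (the listed $d$ are those for which the ideal class group is trivial). For $z\in\mathbb C$ define $$c_d(z)=\inf_{(p,q)\in\mathcal O_d\times(\mathcal O_d\setminus\{0\})}|q|^2\Big|z-\frac pq\Big|,$$ $\mathbf{Bad}_d=\{z\in\mathbb C: c_d(z)>0\}$, and $\mathcal S_d=\{-\log c_d(z): z\in\mathbf{Bad}_d\}$. For $t\in\mathcal S_d$ let $\mathfrak D_d(t)=\dim\{z\in\mathbf{Bad}_d:-\log c_d(z)\le t\}$ and $\mathfrak D_d^0(t)=\dim\{z\in\mathbf{Bad}_d:-\log c_d(z)=t\}$ (Hausdorff dimension). Absolute game. Let $\bar X$ be a proper metric space, $X\subset\bar X$ closed; fix $\beta_*>0$ and $0<\beta<\beta_*$. Bob starts with a metric ball $B_0=B(x_0,r_0)$, $x_0\in X$. At step $k\ge0$, given Bob's ball $B_k=B(x_k,r_k)$ with $x_k\in X$, Alice blocks a ball $A_k=B(y_k,\alpha_kr_k)$ with $y_k\in\bar X$ and $0<\alpha_k<\beta$; then Bob chooses $B_{k+1}=B(x_{k+1},r_{k+1})\subset B_k\setminus A_k$ with $x_{k+1}\in X$, $\beta r_k\le r_{k+1}\le r_k$. A set $Y\subset X$ is $\beta$-absolute winning in $X$ if Alice has a strategy guaranteeing that $\bigcap_{k\ge0}B_k$ meets $Y$, no matter how Bob plays; $Y$ is absolute winning in $X$ (given $\beta_*$) if it is $\beta$-absolute winning for all $0<\beta<\beta_*$.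 "Absolute winning" without mention of $\beta_*$ is understood for some fixed $\beta_*>0$ depending only on the pair $X\subset\bar X$. Here $\bar X=\mathbb C$ with the Euclidean metric and $X=\mathbb C$, respectively $X=S(p/q,r)$. *)

theory Defs
  imports "HOL-Analysis.Analysis" "HOL-Computational_Algebra.Polynomial"
begin

definition imag_quadratic_field :: "nat \<Rightarrow> complex set" where
  "imag_quadratic_field d =
     {of_rat a + of_rat b * (\<i> * complex_of_real (sqrt (real d))) | a b. True}"

definition ring_of_integers :: "nat \<Rightarrow> complex set"  ("\<O>") where
  "\<O> d = {z \<in> imag_quadratic_field d. algebraic_int z}"

definition approx_const :: "nat \<Rightarrow> complex \<Rightarrow> real" where
  "approx_const d z = (INF (p, q) \<in> \<O> d \<times> (\<O> d - {0}). (cmod q)\<^sup>2 * cmod (z - p / q))"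

definition Bad :: "nat \<Rightarrow> complex set" where
  "Bad d = {z. approx_const d z > 0}"

definition spectrum :: "nat \<Rightarrow> real set" where
  "spectrum d = {- ln (approx_const d z) | z. z \<in> Bad d}"

text \<open>Covers are by bounded sets because \<^const>\<open>diameter\<close> is unspecified on unbounded ones.
  The dimension only uses exponents \<^prop>\<open>s > 0\<close>: this does not change the infimum, and it avoids
  the convention \<^prop>\<open>(0::real) powr 0 = 0\<close>.\<close>

definition hausdorff_premeasure :: "real \<Rightarrow> real \<Rightarrow> 'a::metric_space set \<Rightarrow> ennreal" where
  "hausdorff_premeasure s \<delta> A =
     (INF U \<in> {U :: nat \<Rightarrow> 'a set. A \<subseteq> (\<Union>i. U i) \<and> (\<forall>i. bounded (U i) \<and> diameter (U i) \<le> \<delta>)}.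
        (\<Sum>i. ennreal (diameter (U i) powr s)))"

definition hausdorff_measure :: "real \<Rightarrow> 'a::metric_space set \<Rightarrow> ennreal" where
  "hausdorff_measure s A = (SUP \<delta> \<in> {0<..}. hausdorff_premeasure s \<delta> A)"

definition hausdorff_dim :: "'a::metric_space set \<Rightarrow> ereal" where
  "hausdorff_dim A = Inf {ereal s | s. s > 0 \<and> hausdorff_measure s A = 0}"

definition dim_sublevel :: "nat \<Rightarrow> real \<Rightarrow> ereal" where
  "dim_sublevel d t = hausdorff_dim {z \<in> Bad d. (- ln (approx_const d z)) \<le> t}"

definition dim_level :: "nat \<Rightarrow> real \<Rightarrow> ereal" where
  "dim_level d t = hausdorff_dim {z \<in> Bad d. (- ln (approx_const d z)) = t}"

text \<open>The absolute game on \<open>X\<close>, where the ambient space is the (proper) type \<open>'a\<close>. A ball is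
  recorded as a pair of center and radius and denotes the closed ball of the ambient space.
  Alice's move is a pair \<open>(y, \<alpha>)\<close>; the second component is the ratio of the radius of the
  blocked ball to that of Bob's current ball. A strategy for Alice maps the list of all of Bob's
  balls so far to her next move.\<close>

definition bob_legal ::
  "real \<Rightarrow> 'a::metric_space set \<Rightarrow> 'a \<times> real \<Rightarrow> 'a \<times> real \<Rightarrow> 'a \<times> real \<Rightarrow> bool" where
  "bob_legal \<beta> X = (\<lambda>(x, r) (y, \<alpha>) (x', r').
     x' \<in> X \<and> \<beta> * r \<le> r' \<and> r' \<le> r \<and> cball x' r' \<subseteq> cball x r - cball y (\<alpha> * r))"

definition legal_upto ::
  "real \<Rightarrow> 'a::metric_space set \<Rightarrow> (('a \<times> real) list \<Rightarrow> 'a \<times> real) \<Rightarrow> (nat \<Rightarrow> 'a \<times> real) \<Rightarrow> nat \<Rightarrow> bool"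
where
  "legal_upto \<beta> X \<sigma> B n \<longleftrightarrow>
     fst (B 0) \<in> X \<and> 0 < snd (B 0) \<and>
     (\<forall>k<n. bob_legal \<beta> X (B k) (\<sigma> (map B [0..<Suc k])) (B (Suc k)))"

text \<open>A winning strategy must guarantee an infinite play: Alice does not win by leaving Bob
  without a legal move.\<close>

definition beta_absolute_winning :: "real \<Rightarrow> 'a::heine_borel set \<Rightarrow> 'a set \<Rightarrow> bool" where
  "beta_absolute_winning \<beta> X Y \<longleftrightarrow> Y \<subseteq> X \<and>
     (\<exists>\<sigma>. (\<forall>h. 0 < snd (\<sigma> h) \<and> snd (\<sigma> h) < \<beta>) \<and>
        (\<forall>B n. legal_upto \<beta> X \<sigma> B n \<longrightarrow> (\<exists>b. bob_legal \<beta> X (B n) (\<sigma> (map B [0..<Suc n])) b)) \<and>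
        (\<forall>B. (\<forall>n. legal_upto \<beta> X \<sigma> B n) \<longrightarrow> (\<Inter>k. cball (fst (B k)) (snd (B k))) \<inter> Y \<noteq> {}))"

definition absolute_winning :: "real \<Rightarrow> 'a::heine_borel set \<Rightarrow> 'a set \<Rightarrow> bool" where
  "absolute_winning \<beta>s X Y \<longleftrightarrow> (\<forall>\<beta>. 0 < \<beta> \<and> \<beta> < \<beta>s \<longrightarrow> beta_absolute_winning \<beta> X Y)"

end

theory Submission
  imports Defs
begin

text \<open>Everything rests on two elementary facts about fractions \<open>p / q\<close> with \<open>p, q\<close> in \<open>\<O> d\<close>. Distinct
  fractions repel each other: \<open>\<bar>p / q - p' / q'\<bar> \<ge> \<kappa> / \<bar>q q'\<bar>\<close> (\<open>fractions_separated\<close>), so that inside a disc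
  of radius \<open>\<rho>\<close> at most one fraction has \<open>\<bar>q\<bar>\<^sup>2 < \<kappa> / (4 \<rho>)\<close> (\<open>near_fractions_unique\<close>). And fractions are
  plentiful: every \<open>z\<close> satisfies \<open>\<bar>q z - p\<bar> \<le> C / n\<close> for some \<open>q\<close> with \<open>0 < \<bar>q\<bar> \<le> C n\<close>
  (\<open>dirichlet_approximation\<close>).

  In the absolute game Alice watches the scale \<open>\<rho>\<close> of Bob's ball. At most one fraction with
  \<open>\<bar>q\<bar>\<^sup>2 < \<kappa> / (4 \<rho>)\<close> is close to the ball, and she blocks it. A given fraction becomes relevant when
  \<open>\<rho>\<close> is comparable with \<open>1 / \<bar>q\<bar>\<^sup>2\<close>, so the limit point stays at a distance comparable with
  \<open>1 / \<bar>q\<bar>\<^sup>2\<close> from it (\<open>Bad_absolute_winning_of_diffuse\<close>). All that is asked of the playground is that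
  Bob can always step aside from a small block, which holds in the plane and on circles.

  For the lower bounds on dimensions put \<open>c = exp (- t)\<close> and choose \<open>N\<close> of order \<open>1 / sqrt c\<close>. Subdivide a
  square repeatedly into \<open>N\<^sup>2\<close> squares. In each square of side \<open>l\<close> only the fractions with \<open>\<bar>q\<bar>\<^sup>2\<close> of
  order between \<open>1 / (N l)\<close> and \<open>1 / l\<close> are dealt with: at most one of them is close to the square, its
  forbidden disc of radius \<open>c / \<bar>q\<bar>\<^sup>2\<close> is not larger than a subsquare, so a bounded number of the
  \<open>N\<^sup>2\<close> subsquares is lost. The surviving Cantor set has dimension \<open>2 - O (1 / (N\<^sup>2 ln N))\<close>, that is,
  \<open>2 - O (1 / (t exp t))\<close>. For the level sets the same construction is carried out on an arc of the
  circle \<open>\<bar>z\<bar> = c\<close>: there the fraction \<open>0 / 1\<close> contributes exactly the value \<open>c\<close> to the infimum, and all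
  other fractions are kept from contributing less. An arc is divided into only \<open>N\<close> pieces, whence
  \<open>1 - O (1 / (N ln N))\<close>. In particular the level sets are nonempty for large \<open>t\<close>, which gives the half line in
  the spectrum. The dimension of the Cantor sets is bounded below by \<open>limit_set_not_null\<close>.

  For the upper bounds, a point \<open>z\<close> with constant at least \<open>c\<close> cannot have a Dirichlet approximation with
  small \<open>q\<close>; hence within any distance \<open>l \<le> 1\<close> of \<open>z\<close> there is a fraction with \<open>\<bar>q\<bar>\<^sup>2 = O (1 / (c l))\<close>, around
  which a disc of radius \<open>c / \<bar>q\<bar>\<^sup>2\<close>, at least of order \<open>c\<^sup>2 l\<close>, is missed by the set
  (\<open>fraction_near_badly_approximable\<close>). So each grid square loses one of its \<open>N\<^sup>2\<close> subsquares for \<open>N\<close> of order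
  \<open>1 / c\<^sup>2 = exp (2 t)\<close>, and the dimension is at most \<open>2 - 1 / (N\<^sup>2 ln N)\<close> (\<open>grid_porous_dim_le\<close>).\<close>

section \<open>Integers of an imaginary quadratic field\<close>

text \<open>The order \<open>\<int>[i sqrt d]\<close>. It is contained in \<open>\<O> d\<close> and contains \<open>2 d \<O> d\<close>, so arithmetic in
  \<open>\<O> d\<close> can be done with integer coordinates up to a bounded denominator.\<close>

definition sqrt_lattice :: "nat \<Rightarrow> complex set" where
  "sqrt_lattice d = {of_int x + of_int y * (\<i> * complex_of_real (sqrt (real d))) | x y. True}"

lemma Re_of_rat [simp]: "Re (of_rat a) = of_rat a" and Im_of_rat [simp]: "Im (of_rat a) = 0"
proof -
  have "(of_rat a :: complex) = complex_of_real (of_rat a)"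
    by (cases a) (simp add: of_rat_rat)
  then show "Re (of_rat a) = of_rat a" "Im (of_rat a) = 0" by simp_all
qed

lemma sqrt_lattice_of_int: "of_int x \<in> sqrt_lattice d"
  unfolding sqrt_lattice_def by (rule CollectI, rule exI[of _ x], rule exI[of _ 0]) simp

lemma sqrt_lattice_add:
  assumes "u \<in> sqrt_lattice d" "v \<in> sqrt_lattice d" shows "u + v \<in> sqrt_lattice d"
proof -
  obtain x y x' y' where "u = of_int x + of_int y * (\<i> * complex_of_real (sqrt (real d)))"
    "v = of_int x' + of_int y' * (\<i> * complex_of_real (sqrt (real d)))"
    using assms unfolding sqrt_lattice_def by blast
  then have "u + v = of_int (x + x') + of_int (y + y') * (\<i> * complex_of_real (sqrt (real d)))"
    by (simp add: algebra_simps)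
  then show ?thesis unfolding sqrt_lattice_def by blast
qed

lemma sqrt_lattice_mult:
  assumes "u \<in> sqrt_lattice d" "v \<in> sqrt_lattice d" shows "u * v \<in> sqrt_lattice d"
proof -
  obtain x y x' y' where uv: "u = of_int x + of_int y * (\<i> * complex_of_real (sqrt (real d)))"
    "v = of_int x' + of_int y' * (\<i> * complex_of_real (sqrt (real d)))"
    using assms unfolding sqrt_lattice_def by blast
  have "u * v = of_int (x * x' - int d * y * y') + of_int (x * y' + y * x') * (\<i> * complex_of_real (sqrt (real d)))"
    unfolding uv by (simp add: complex_eq_iff algebra_simps)
  then show ?thesis unfolding sqrt_lattice_def by blast
qed

lemma sqrt_lattice_diff:
  assumes "u \<in> sqrt_lattice d" "v \<in> sqrt_lattice d" shows "u - v \<in> sqrt_lattice d"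
  using sqrt_lattice_add[OF assms(1) sqrt_lattice_mult[OF sqrt_lattice_of_int[of "-1"] assms(2)]]
  by simp

lemma sqrt_lattice_sum: "(\<And>i. i \<in> I \<Longrightarrow> f i \<in> sqrt_lattice d) \<Longrightarrow> sum f I \<in> sqrt_lattice d"
proof (induction I rule: infinite_finite_induct)
  case (insert x F)
  then show ?case by (simp add: sqrt_lattice_add)
qed (use sqrt_lattice_of_int[of 0] in auto)

lemma sqrt_lattice_norm:
  assumes "u \<in> sqrt_lattice d" shows "(cmod u)\<^sup>2 \<in> \<int>"
proof -
  obtain x y where u: "u = of_int x + of_int y * (\<i> * complex_of_real (sqrt (real d)))"
    using assms unfolding sqrt_lattice_def by blast
  have "(cmod u)\<^sup>2 = of_int (x\<^sup>2 + int d * y\<^sup>2)"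
    unfolding u cmod_power2 by (simp add: power_mult_distrib)
  then show ?thesis by (metis Ints_of_int)
qed

lemma norm_ge_1_of_norm_Ints:
  assumes "(cmod u)\<^sup>2 \<in> \<int>" "u \<noteq> 0" shows "1 \<le> cmod u"
proof -
  have "(cmod u)\<^sup>2 > 0" using assms(2) by simp
  moreover obtain n :: int where n: "(cmod u)\<^sup>2 = of_int n"
    using assms(1) by (auto elim: Ints_cases)
  ultimately have "n \<ge> 1" by simp
  then have "(cmod u)\<^sup>2 \<ge> 1" using n by simp
  then show ?thesis by (simp add: power2_nonneg_ge_1_iff)
qed

text \<open>In lowest terms \<open>x = u / v\<close>, every power of \<open>v\<close> divides \<open>D\<close>, which forces \<open>v = 1\<close>.\<close>

lemma power_denominators_imp_Ints:
  fixes x :: real and D :: int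
  assumes "x \<in> \<rat>" "D \<noteq> 0" "\<And>k. of_int D * x ^ k \<in> \<int>"
  shows "x \<in> \<int>"
proof -
  obtain u v :: int where uv: "v > 0" "coprime u v" "x = of_int u / of_int v"
    using Rats_cases'[OF assms(1)] by metis
  have dv: "v ^ k dvd D" for k
  proof -
    obtain n :: int where n: "of_int D * x ^ k = of_int n" using assms(3) by (metis Ints_cases)
    then have "of_int D * of_int u ^ k = (of_int n * of_int v ^ k :: real)"
      using uv by (simp add: field_simps)
    then have "D * u ^ k = n * v ^ k"
      by (metis (mono_tags, opaque_lifting) of_int_eq_iff of_int_mult of_int_power)
    then have "v ^ k dvd D * u ^ k" by simp
    moreover have "coprime (v ^ k) (u ^ k)" using uv(2) by (simp add: coprime_commute)
    ultimately show ?thesis by (simp add: coprime_dvd_mult_left_iff)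
  qed
  have "v = 1"
  proof (rule ccontr)
    assume "v \<noteq> 1"
    then have "v \<ge> 2" using uv(1) by simp
    have "int (nat \<bar>D\<bar>) < 2 ^ nat \<bar>D\<bar>" by (metis of_nat_less_two_power)
    also have "\<dots> \<le> v ^ nat \<bar>D\<bar>" using \<open>v \<ge> 2\<close> by (intro power_mono) auto
    also have "\<dots> \<le> \<bar>D\<bar>" using dv assms(2) by (meson dvd_imp_le_int order_trans abs_ge_self)
    finally show False by simp
  qed
  then show ?thesis using uv by simp
qed

lemma Rats_power2_Ints:
  fixes x :: real
  assumes "x \<in> \<rat>" "x\<^sup>2 \<in> \<int>" shows "x \<in> \<int>"
proof -
  have "algebraic_int x"
  proof (rule algebraic_int_root[OF int_imp_algebraic_int[OF assms(2)]])
    show "poly (monom 1 2) x = x\<^sup>2" by (simp add: poly_monom)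
  qed (auto simp: degree_monom_eq)
  then show ?thesis using assms(1) by (rule rational_algebraic_int_is_int)
qed

text \<open>A monic integral equation of degree \<open>n\<close> expresses every power of \<open>z\<close> through the first \<open>n\<close> ones with
  integral coefficients. If \<open>e z\<close> lies in the order, \<open>e ^ n\<close> clears the denominators of those.\<close>

lemma algebraic_int_powers_common_denominator:
  assumes "algebraic_int z" "z \<in> imag_quadratic_field d"
  shows "\<exists>D::int. D \<noteq> 0 \<and> (\<forall>k. of_int D * z ^ k \<in> sqrt_lattice d)"
proof -
  obtain p :: "int poly" where p: "poly (map_poly of_int p) z = 0" "lead_coeff p = 1"
    using assms(1) unfolding algebraic_int_altdef_ipoly by blast
  define n where "n = degree p"
  obtain a b where z: "z = of_rat a + of_rat b * (\<i> * complex_of_real (sqrt (real d)))"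
    using assms(2) unfolding imag_quadratic_field_def by blast
  obtain a1 a2 b1 b2 :: int where ab: "a = of_int a1 / of_int a2" "a2 \<noteq> 0" "b = of_int b1 / of_int b2" "b2 \<noteq> 0"
    by (metis Rat_cases Fract_of_int_quotient less_irrefl)
  define e where "e = a2 * b2"
  have e0: "e \<noteq> 0" using ab by (simp add: e_def)
  have ez: "of_int e * z \<in> sqrt_lattice d"
  proof -
    have "of_int a2 * of_rat a = (of_int a1 :: complex)" "of_int b2 * of_rat b = (of_int b1 :: complex)"
      using ab by (simp_all add: of_rat_divide)
    moreover have "of_int e * z = of_int b2 * (of_int a2 * of_rat a)
        + of_int a2 * (of_int b2 * of_rat b) * (\<i> * complex_of_real (sqrt (real d)))"
      by (simp add: z e_def algebra_simps)
    ultimately have "of_int e * z = of_int (b2 * a1) + of_int (a2 * b1) * (\<i> * complex_of_real (sqrt (real d)))"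
      by simp
    then show ?thesis unfolding sqrt_lattice_def by blast
  qed
  have epow: "(of_int e * z) ^ k \<in> sqrt_lattice d" for k
    by (induction k) (use sqrt_lattice_of_int[of 1] ez in \<open>auto intro: sqrt_lattice_mult\<close>)
  define D where "D = e ^ n"
  have "of_int D * z ^ k \<in> sqrt_lattice d" for k
  proof (induction k rule: less_induct)
    case (less k)
    show ?case
    proof (cases "k < n")
      case True
      then have "of_int D * z ^ k = of_int (e ^ (n - k)) * (of_int e * z) ^ k"
        by (simp add: D_def power_mult_distrib mult.assoc flip: power_add)
      then show ?thesis using sqrt_lattice_mult[OF sqrt_lattice_of_int epow] by metis
    next
      case False
      have "0 = (\<Sum>i\<le>n. of_int (coeff p i) * z ^ i)"
        using p(1) by (simp add: poly_altdef n_def degree_map_poly coeff_map_poly)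
      also have "\<dots> = z ^ n + (\<Sum>i<n. of_int (coeff p i) * z ^ i)"
        using p(2) by (simp add: n_def lessThan_Suc_atMost[symmetric])
      finally have zn: "z ^ n = - (\<Sum>i<n. of_int (coeff p i) * z ^ i)"
        by (simp add: eq_neg_iff_add_eq_0)
      have "of_int D * z ^ k = of_int D * z ^ (k - n) * z ^ n"
        using False by (simp add: mult.assoc flip: power_add)
      also have "\<dots> = (\<Sum>i<n. of_int (- coeff p i) * (of_int D * z ^ (k - n + i)))"
        unfolding zn by (simp add: sum_distrib_left sum_negf power_add mult_ac)
      also have "\<dots> \<in> sqrt_lattice d"
        using False by (intro sqrt_lattice_sum sqrt_lattice_mult[OF sqrt_lattice_of_int] less) auto
      finally show ?thesis .
    qed
  qed
  then show ?thesis using e0 by (intro exI[of _ D]) (auto simp: D_def)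
qed

text \<open>The norms of the elements \<open>D z ^ k\<close> of the order are \<open>D\<^sup>2 \<bar>z\<bar>^ (2 k)\<close>, so all powers of the rational number
  \<open>\<bar>z\<bar>\<^sup>2\<close> have denominators dividing \<open>D\<^sup>2\<close>.\<close>

lemma common_denominator_imp_norm_Ints:
  assumes z: "z = of_rat a + of_rat b * (\<i> * complex_of_real (sqrt (real d)))"
    and D: "D \<noteq> (0::int)" "\<And>k. of_int D * z ^ k \<in> sqrt_lattice d"
  shows "(cmod z)\<^sup>2 \<in> \<int>"
proof (rule power_denominators_imp_Ints)
  have "(cmod z)\<^sup>2 = of_rat (a\<^sup>2 + of_nat d * b\<^sup>2)"
    unfolding z cmod_power2 by (simp add: of_rat_add of_rat_mult of_rat_power power_mult_distrib)
  then show "(cmod z)\<^sup>2 \<in> \<rat>" by simp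
  show "D\<^sup>2 \<noteq> 0" using D by simp
  show "of_int (D\<^sup>2) * ((cmod z)\<^sup>2) ^ k \<in> \<int>" for k
    using sqrt_lattice_norm[OF D(2)[of k]]
    by (simp add: norm_mult norm_power power_mult_distrib power_mult[symmetric] mult.commute)
qed

text \<open>Makes the norm argument available for \<open>z + 1\<close>; the norms of \<open>z\<close> and \<open>z + 1\<close> together give the trace.\<close>

lemma common_denominator_plus_1:
  assumes "\<And>k. of_int D * z ^ k \<in> sqrt_lattice d"
  shows "of_int D * (z + 1) ^ k \<in> sqrt_lattice d"
proof -
  have "of_int D * (z + 1) ^ k = (\<Sum>j\<le>k. of_int (int (k choose j)) * (of_int D * z ^ j))"
    by (simp add: binomial_ring sum_distrib_left mult_ac)
  also have "\<dots> \<in> sqrt_lattice d"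
    by (intro sqrt_lattice_sum sqrt_lattice_mult[OF sqrt_lattice_of_int] assms)
  finally show ?thesis .
qed

text \<open>Write \<open>z = a + b i sqrt d\<close>. The trace \<open>2 a = \<bar>z + 1\<bar>\<^sup>2 - \<bar>z\<bar>\<^sup>2 - 1\<close> is an integer, hence so is
  \<open>(2 d b)\<^sup>2 = d (4 \<bar>z\<bar>\<^sup>2 - (2 a)\<^sup>2)\<close>, and a rational number with integral square is integral.\<close>

lemma ring_of_integers_denominator:
  assumes "z \<in> \<O> d"
  shows "of_int (2 * int d) * z \<in> sqrt_lattice d" and "(cmod z)\<^sup>2 \<in> \<int>"
proof -
  have zf: "z \<in> imag_quadratic_field d" and za: "algebraic_int z"
    using assms by (auto simp: ring_of_integers_def)
  obtain a b where z: "z = of_rat a + of_rat b * (\<i> * complex_of_real (sqrt (real d)))"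
    using zf unfolding imag_quadratic_field_def by blast
  obtain D :: int where D: "D \<noteq> 0" "\<And>k. of_int D * z ^ k \<in> sqrt_lattice d"
    using algebraic_int_powers_common_denominator[OF za zf] by blast
  show N: "(cmod z)\<^sup>2 \<in> \<int>" by (rule common_denominator_imp_norm_Ints[OF z D])
  have z1: "z + 1 = of_rat (a + 1) + of_rat b * (\<i> * complex_of_real (sqrt (real d)))"
    by (simp add: z of_rat_add)
  have N1: "(cmod (z + 1))\<^sup>2 \<in> \<int>"
    by (rule common_denominator_imp_norm_Ints[OF z1 D(1) common_denominator_plus_1[OF D(2)]])
  have "2 * of_rat a = (cmod (z + 1))\<^sup>2 - (cmod z)\<^sup>2 - 1"
    unfolding z1 z cmod_power2 by (simp add: of_rat_add power2_eq_square algebra_simps)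
  then have a: "2 * of_rat a \<in> (\<int> :: real set)" using N N1 by simp
  have "(of_rat (2 * of_nat d * b) :: real)\<^sup>2 = of_nat d * (4 * (cmod z)\<^sup>2 - (2 * of_rat a)\<^sup>2)"
    unfolding z cmod_power2 by (simp add: of_rat_mult power_mult_distrib) (simp add: power2_eq_square)
  also have "\<dots> \<in> \<int>"
    by (rule Ints_mult[OF Ints_of_nat Ints_diff[OF Ints_mult[OF Ints_numeral N] Ints_power[OF a]]])
  finally have "(of_rat (2 * of_nat d * b) :: real) \<in> \<int>" by (rule Rats_power2_Ints[OF Rats_of_rat])
  then obtain y :: int where y: "of_rat (2 * of_nat d * b) = (of_int y :: real)" by (rule Ints_cases)
  from a obtain x :: int where x: "2 * of_rat a = (of_int x :: real)" by (rule Ints_cases)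
  have cx: "2 * of_rat a = (of_int x :: complex)"
    using x by (simp add: complex_eq_iff)
  have cy: "2 * of_nat d * of_rat b = (of_int y :: complex)"
    using y by (simp add: complex_eq_iff of_rat_mult)
  have "of_int (2 * int d) * z = of_nat d * (2 * of_rat a) + (2 * of_nat d * of_rat b) * (\<i> * complex_of_real (sqrt (real d)))"
    by (simp add: z algebra_simps)
  also have "\<dots> = of_int (int d * x) + of_int y * (\<i> * complex_of_real (sqrt (real d)))"
    unfolding cx cy by simp
  finally show "of_int (2 * int d) * z \<in> sqrt_lattice d" unfolding sqrt_lattice_def by blast
qed

lemma ring_of_integers_norm_ge_1: "z \<in> \<O> d \<Longrightarrow> z \<noteq> 0 \<Longrightarrow> 1 \<le> cmod z"
  by (rule norm_ge_1_of_norm_Ints[OF ring_of_integers_denominator(2)])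

lemma sqrt_lattice_subset_ring_of_integers: "sqrt_lattice d \<subseteq> \<O> d"
proof
  fix z assume "z \<in> sqrt_lattice d"
  then obtain x y where z: "z = of_int x + of_int y * (\<i> * complex_of_real (sqrt (real d)))"
    unfolding sqrt_lattice_def by blast
  have "z \<in> imag_quadratic_field d"
    unfolding imag_quadratic_field_def z
    by (rule CollectI, rule exI[of _ "of_int x"], rule exI[of _ "of_int y"]) simp
  moreover have "algebraic_int z"
    unfolding algebraic_int_altdef_ipoly
  proof (intro exI conjI)
    let ?p = "[:x\<^sup>2 + int d * y\<^sup>2, - 2 * x, 1:] :: int poly"
    show "poly (map_poly of_int ?p) z = 0"
      by (simp add: z map_poly_pCons complex_eq_iff power2_eq_square algebra_simps)
    show "lead_coeff ?p = 1" by simp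
  qed
  ultimately show "z \<in> \<O> d" by (simp add: ring_of_integers_def)
qed

lemma zero_one_in_ring_of_integers: "0 \<in> \<O> d" "1 \<in> \<O> d"
  using sqrt_lattice_subset_ring_of_integers sqrt_lattice_of_int[of 0] sqrt_lattice_of_int[of 1] by auto

text \<open>A lower bound for the modulus of a nonzero determinant \<open>p q' - p' q\<close> with entries in \<open>\<O> d\<close>: both
  products have denominator \<open>(2 d)\<^sup>2\<close> with respect to \<open>\<int>[i sqrt d]\<close>.\<close>

definition sep_const :: "nat \<Rightarrow> real" where
  "sep_const d = 1 / (4 * (real d)\<^sup>2)"

lemma sep_const_pos: "d > 0 \<Longrightarrow> 0 < sep_const d"
  by (simp add: sep_const_def)

lemma fractions_separated:
  assumes d: "d > 0" and O: "p \<in> \<O> d" "q \<in> \<O> d" "p' \<in> \<O> d" "q' \<in> \<O> d"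
    and nz: "q \<noteq> 0" "q' \<noteq> 0" and ne: "p / q \<noteq> p' / q'"
  shows "sep_const d / (cmod q * cmod q') \<le> dist (p / q) (p' / q')"
proof -
  let ?D = "of_int (2 * int d) :: complex"
  have "(?D * p) * (?D * q') - (?D * p') * (?D * q) \<in> sqrt_lattice d"
    by (intro sqrt_lattice_diff sqrt_lattice_mult ring_of_integers_denominator O)
  moreover have eq: "(?D * p) * (?D * q') - (?D * p') * (?D * q) = ?D\<^sup>2 * (p * q' - p' * q)"
    by (simp add: power2_eq_square algebra_simps)
  moreover have pq: "p * q' - p' * q \<noteq> 0" using ne nz by (auto simp: field_simps)
  ultimately have "1 \<le> cmod (?D\<^sup>2 * (p * q' - p' * q))"
    using d by (intro norm_ge_1_of_norm_Ints sqrt_lattice_norm) auto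
  then have "1 \<le> (2 * real d)\<^sup>2 * cmod (p * q' - p' * q)"
    by (simp add: norm_mult norm_power)
  then have "sep_const d \<le> cmod (p * q' - p' * q)"
    using d by (simp add: sep_const_def field_simps power_mult_distrib)
  moreover have "dist (p / q) (p' / q') = cmod (p * q' - p' * q) / (cmod q * cmod q')"
    using nz by (simp add: dist_norm diff_frac_eq norm_divide norm_mult)
  ultimately show ?thesis by (simp add: divide_right_mono)
qed

text \<open>Two different fractions with \<open>\<bar>q\<bar>\<^sup>2 < \<kappa> / (4 \<rho>)\<close> are at least \<open>4 \<rho>\<close> apart, because
  \<open>\<bar>q q'\<bar>\<close> is at most the mean of \<open>\<bar>q\<bar>\<^sup>2\<close> and \<open>\<bar>q'\<bar>\<^sup>2\<close>. Thus at every scale only one fraction has to be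
  avoided at a time.\<close>

lemma near_fractions_unique:
  assumes d: "d > 0" and O: "p \<in> \<O> d" "q \<in> \<O> d" "p' \<in> \<O> d" "q' \<in> \<O> d" "q \<noteq> 0" "q' \<noteq> 0"
    and h: "4 * \<rho> * (cmod q)\<^sup>2 < sep_const d" "4 * \<rho> * (cmod q')\<^sup>2 < sep_const d"
    and D: "dist (p / q) (p' / q') < 4 * \<rho>"
  shows "p / q = p' / q'"
proof (rule ccontr)
  assume "p / q \<noteq> p' / q'"
  then have "sep_const d / (cmod q * cmod q') < 4 * \<rho>"
    using fractions_separated[OF d O] D by linarith
  then have k: "sep_const d < 4 * \<rho> * (cmod q * cmod q')" using O by (simp add: field_simps)
  have "\<rho> > 0" using D zero_le_dist[of "p / q" "p' / q'"] by linarith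
  have "2 * (cmod q * cmod q') \<le> (cmod q)\<^sup>2 + (cmod q')\<^sup>2"
    using sum_squares_bound[of "cmod q" "cmod q'"] by simp
  then have "4 * \<rho> * (2 * (cmod q * cmod q')) \<le> 4 * \<rho> * ((cmod q)\<^sup>2 + (cmod q')\<^sup>2)"
    using \<open>\<rho> > 0\<close> by (intro mult_left_mono) auto
  then show False using h k by (simp add: algebra_simps)
qed

lemma floor_mult_eq_imp_close:
  fixes x y :: real
  assumes "\<lfloor>real n * x\<rfloor> = \<lfloor>real n * y\<rfloor>" "n > 0" shows "\<bar>x - y\<bar> \<le> 1 / n"
proof -
  have "\<bar>real n * x - real n * y\<bar> \<le> 1" using assms(1) by linarith
  then have "real n * \<bar>x - y\<bar> \<le> 1" by (simp add: abs_mult flip: right_diff_distrib)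
  then show ?thesis using assms(2) by (simp add: field_simps)
qed

text \<open>Pigeonhole: the \<open>(n + 1)\<^sup>2\<close> products \<open>(a + b i sqrt d) z\<close> with \<open>0 \<le> a, b \<le> n\<close>, reduced modulo
  \<open>\<int>[i sqrt d]\<close>, lie in a parallelogram that is cut into \<open>n\<^sup>2\<close> cells, and two of them share a cell.\<close>

lemma dirichlet_approximation:
  fixes n :: nat
  assumes d: "d > 0" and n: "n > 0"
  shows "\<exists>p\<in>\<O> d. \<exists>q\<in>\<O> d. q \<noteq> 0 \<and> cmod q \<le> (1 + sqrt d) * n \<and> cmod (q * z - p) \<le> (1 + sqrt d) / n"
proof -
  define w where "w = \<i> * complex_of_real (sqrt (real d))"
  have w: "cmod w = sqrt d" by (simp add: w_def norm_mult)
  have sd: "sqrt (real d) > 0" using d by simp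
  define Q where "Q = (\<lambda>(a, b). of_nat a + of_nat b * w :: complex)"
  define X where "X = (\<lambda>v. Re (Q v * z))"
  define Y where "Y = (\<lambda>v. Im (Q v * z) / sqrt d)"
  have XY: "Q v * z = of_real (X v) + of_real (Y v) * w" for v
    using sd by (simp add: X_def Y_def w_def complex_eq_iff)
  define g where "g = (\<lambda>v. (\<lfloor>real n * frac (X v)\<rfloor>, \<lfloor>real n * frac (Y v)\<rfloor>))"
  have cell: "\<lfloor>real n * frac x\<rfloor> \<in> {0..<int n}" for x
  proof -
    have "real n * frac x < real n * 1" using n frac_lt_1 by (intro mult_strict_left_mono) auto
    then show ?thesis using n by (simp add: floor_less_iff)
  qed
  have "g ` ({0..n} \<times> {0..n}) \<subseteq> {0..<int n} \<times> {0..<int n}"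
    unfolding g_def using cell by auto
  then have "card (g ` ({0..n} \<times> {0..n})) \<le> n * n"
    by (metis card_atLeastLessThan_int card_cartesian_product card_mono diff_zero finite_SigmaI
        finite_atLeastLessThan_int nat_int)
  also have "n * n < card ({0..n} \<times> {0..n})" by simp
  finally obtain v v' where v: "v \<in> {0..n} \<times> {0..n}" "v' \<in> {0..n} \<times> {0..n}" "v \<noteq> v'" "g v = g v'"
    using pigeonhole[of g "{0..n} \<times> {0..n}"] by (auto simp: inj_on_def)
  obtain a b a' b' where ab: "v = (a, b)" "v' = (a', b')" by (metis surj_pair)
  define q where "q = of_int (int a - int a') + of_int (int b - int b') * w"
  define p where "p = of_int (\<lfloor>X v\<rfloor> - \<lfloor>X v'\<rfloor>) + of_int (\<lfloor>Y v\<rfloor> - \<lfloor>Y v'\<rfloor>) * w"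
  have "p \<in> sqrt_lattice d" "q \<in> sqrt_lattice d"
    unfolding p_def q_def w_def sqrt_lattice_def by blast+
  then have O: "p \<in> \<O> d" "q \<in> \<O> d" using sqrt_lattice_subset_ring_of_integers by auto
  have q0: "q \<noteq> 0"
    using v(3) sd by (auto simp: ab q_def w_def complex_eq_iff)
  have "cmod q \<le> real_of_int \<bar>int a - int a'\<bar> + real_of_int \<bar>int b - int b'\<bar> * sqrt d"
    unfolding q_def by (rule norm_triangle_le) (simp add: norm_mult w del: of_int_diff)
  also have "\<dots> \<le> n + n * sqrt d"
    using v(1,2) by (intro add_mono mult_right_mono) (auto simp: ab)
  finally have qn: "cmod q \<le> (1 + sqrt d) * n" by (simp add: algebra_simps)
  have "q * z - p = (Q v * z - Q v' * z) - p"
    by (simp add: q_def Q_def ab algebra_simps)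
  also have "\<dots> = of_real (frac (X v) - frac (X v')) + of_real (frac (Y v) - frac (Y v')) * w"
    unfolding XY p_def by (simp add: frac_def algebra_simps)
  also have "cmod \<dots> \<le> \<bar>frac (X v) - frac (X v')\<bar> + \<bar>frac (Y v) - frac (Y v')\<bar> * sqrt d"
    by (rule norm_triangle_le) (simp add: norm_mult w del: of_real_diff)
  also have "\<dots> \<le> 1 / n + 1 / n * sqrt d"
    using v(4) n by (intro add_mono mult_right_mono floor_mult_eq_imp_close) (auto simp: g_def)
  finally have "cmod (q * z - p) \<le> (1 + sqrt d) / n" by (simp add: algebra_simps add_divide_distrib)
  then show ?thesis using O q0 qn by blast
qed

section \<open>The approximation constant\<close>

lemma approx_const_ge_iff:
  "c \<le> approx_const d z \<longleftrightarrow>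
    (\<forall>p\<in>\<O> d. \<forall>q\<in>\<O> d. q \<noteq> 0 \<longrightarrow> c \<le> (cmod q)\<^sup>2 * dist z (p / q))"
proof -
  have ne: "\<O> d \<times> (\<O> d - {0}) \<noteq> {}" using zero_one_in_ring_of_integers[of d] by auto
  have bdd: "bdd_below ((\<lambda>(p, q). (cmod q)\<^sup>2 * cmod (z - p / q)) ` (\<O> d \<times> (\<O> d - {0})))"
    by (rule bdd_belowI[of _ 0]) auto
  show ?thesis
    unfolding approx_const_def le_cINF_iff[OF ne bdd] by (auto simp: dist_norm)
qed

lemma Bad_iff:
  "z \<in> Bad d \<longleftrightarrow>
    (\<exists>c>0. \<forall>p\<in>\<O> d. \<forall>q\<in>\<O> d. q \<noteq> 0 \<longrightarrow> c \<le> (cmod q)\<^sup>2 * dist z (p / q))"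
  unfolding approx_const_ge_iff[symmetric] Bad_def by (metis mem_Collect_eq order.strict_trans2 order_refl)

lemma sublevel_eq:
  "{z \<in> Bad d. - ln (approx_const d z) \<le> t} = {z. exp (- t) \<le> approx_const d z}"
proof -
  have "x > 0 \<and> - ln x \<le> t \<longleftrightarrow> exp (- t) \<le> x" for x :: real
    by (smt (verit) exp_gt_zero ln_ge_iff)
  then show ?thesis by (auto simp: Bad_def)
qed

lemma level_eq:
  "{z \<in> Bad d. - ln (approx_const d z) = t} = {z. approx_const d z = exp (- t)}"
proof -
  have "x > 0 \<and> - ln x = t \<longleftrightarrow> x = exp (- t)" for x :: real
    by (metis add.inverse_inverse exp_gt_zero exp_ln ln_exp)
  then show ?thesis by (auto simp: Bad_def)
qed

section \<open>The absolute game\<close>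

lemma cballs_meet:
  fixes x y :: "'a::real_normed_vector"
  assumes "dist x y \<le> r + s" "0 < r" "0 < s"
  shows "cball x r \<inter> cball y s \<noteq> {}"
proof -
  define t where "t = r / (r + s)"
  have t: "0 \<le> t" "1 - t = s / (r + s)" using assms by (auto simp: t_def field_simps)
  define z where "z = x + t *\<^sub>R (y - x)"
  have "dist x z = t * dist x y" "dist y z = (1 - t) * dist x y"
  proof -
    show "dist x z = t * dist x y" using t by (simp add: z_def dist_norm norm_minus_commute)
    have "y - z = (1 - t) *\<^sub>R (y - x)" by (simp add: z_def algebra_simps)
    moreover have "0 \<le> 1 - t" using t assms by simp
    ultimately show "dist y z = (1 - t) * dist x y" by (simp add: dist_norm norm_minus_commute)
  qed
  moreover have "t * dist x y \<le> t * (r + s)" using t assms by (intro mult_left_mono) auto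
  moreover have "(1 - t) * dist x y \<le> (1 - t) * (r + s)" using t assms by (intro mult_left_mono) auto
  moreover have "t * (r + s) = r" "(1 - t) * (r + s) = s" using t assms by (auto simp: t_def)
  ultimately have "z \<in> cball x r \<inter> cball y s" by simp
  then show ?thesis by blast
qed

text \<open>If the blocked centre is not much farther from \<open>x\<close> than \<open>r\<close>, a legal answer must keep the distance
  \<open>r' + \<alpha> r\<close> from it while staying inside the old ball, which is impossible when \<open>r'\<close> is close to \<open>r\<close>.\<close>

lemma bob_legal_shrinks:
  fixes x x' y :: complex
  assumes "bob_legal \<beta> X (x, r) (y, \<alpha>) (x', r')" "0 < r'" "0 < \<alpha>" "0 < r"
    and "dist x y \<le> (1 + \<alpha> / 4) * r"
  shows "r' \<le> (1 - 3 * \<alpha> / 8) * r"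
proof -
  have sub: "cball x' r' \<subseteq> cball x r - cball y (\<alpha> * r)" using assms(1) by (simp add: bob_legal_def)
  then have 1: "dist x' x + r' \<le> r" using assms(2) cball_subset_cball_iff[of x' r' x r] by auto
  have "\<not> dist x' y \<le> r' + \<alpha> * r"
  proof
    assume "dist x' y \<le> r' + \<alpha> * r"
    then have "cball x' r' \<inter> cball y (\<alpha> * r) \<noteq> {}"
      using assms by (intro cballs_meet) auto
    then show False using sub by blast
  qed
  moreover have "dist x' y \<le> dist x' x + dist x y" by (rule dist_triangle)
  ultimately show ?thesis using 1 assms(5) by (simp add: algebra_simps)
qed

text \<open>Alice's strategy. Let Bob's ball have centre \<open>x\<close> and radius \<open>\<rho>\<close>. If \<open>\<rho> \<le> R\<close> and there is a
  fraction with \<open>\<bar>q\<bar>\<^sup>2 < \<kappa> / (4 \<rho>)\<close> within \<open>(1 + \<alpha> / 4) \<rho>\<close> of \<open>x\<close>, it is unique and she blocks it.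
  Otherwise she blocks the boundary point \<open>x + \<rho>\<close>: this makes the ball shrink, yet Bob can keep
  his centre, which matters as long as the ball is large compared with \<open>X\<close>. By diffuseness Bob also has an answer
  in the first case, so the game never stops, and the radii decrease geometrically to \<open>0\<close>.

  A fraction \<open>p / q\<close> is taken into account at the first step where \<open>\<rho> \<le> R\<close> and
  \<open>4 \<rho> \<bar>q\<bar>\<^sup>2 < \<kappa>\<close>. At that step either it is blocked or it is at distance more than
  \<open>\<alpha> \<rho> / 4\<close> from Bob's ball, and \<open>\<rho>\<close> is bounded below by a multiple of \<open>1 / \<bar>q\<bar>\<^sup>2\<close>, since radii shrink by
  at most the factor \<open>\<beta>\<close> per step.\<close>

lemma Bad_absolute_winning_of_diffuse:
  fixes X :: "complex set"
  assumes d: "d > 0" and X: "closed X" and R: "0 < R"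
    and diffuse: "\<And>x \<rho> y. x \<in> X \<Longrightarrow> 0 < \<rho> \<Longrightarrow> \<rho> \<le> R \<Longrightarrow> \<exists>x'\<in>X. dist x x' \<le> \<rho> / 2 \<and> \<rho> / 4 \<le> dist x' y"
  shows "absolute_winning (1 / 10) X (Bad d \<inter> X)"
  unfolding absolute_winning_def
proof (intro allI impI)
  fix \<beta> :: real assume "0 < \<beta> \<and> \<beta> < 1 / 10"
  then have \<beta>: "0 < \<beta>" "\<beta> < 1 / 10" by auto
  define \<alpha> where "\<alpha> = \<beta> / 2"
  have \<alpha>: "0 < \<alpha>" "\<alpha> < \<beta>" "\<alpha> < 1 / 20" using \<beta> by (auto simp: \<alpha>_def)
  define \<kappa> where "\<kappa> = sep_const d"
  have \<kappa>: "\<kappa> > 0" using d by (simp add: \<kappa>_def sep_const_pos)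
  define near where "near x \<rho> = {p / q | p q. p \<in> \<O> d \<and> q \<in> \<O> d \<and> q \<noteq> 0
      \<and> 4 * \<rho> * (cmod q)\<^sup>2 < \<kappa> \<and> dist x (p / q) \<le> (1 + \<alpha> / 4) * \<rho>}" for x \<rho>
  define blk where "blk b = (if snd b \<le> R \<and> near (fst b) (snd b) \<noteq> {}
      then SOME y. y \<in> near (fst b) (snd b) else fst b + of_real (snd b))" for b
  define \<sigma> where "\<sigma> h = (blk (last h), \<alpha>)" for h :: "(complex \<times> real) list"
  have \<sigma>: "\<sigma> (map B [0..<Suc n]) = (blk (B n), \<alpha>)" for B n
    by (simp add: \<sigma>_def)
  have blk_near: "blk (x, \<rho>) \<in> near x \<rho>" if "\<rho> \<le> R" "near x \<rho> \<noteq> {}" for x \<rho>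
    using that by (simp add: blk_def some_in_eq)
  have blk_far: "blk (x, \<rho>) = x + of_real \<rho>" if "\<not> (\<rho> \<le> R \<and> near x \<rho> \<noteq> {})" for x \<rho>
    using that by (auto simp: blk_def)
  \<comment> \<open>in either case the block is near enough to make Bob's ball shrink\<close>
  have blk_dist: "dist x (blk (x, \<rho>)) \<le> (1 + \<alpha> / 4) * \<rho>" if "0 < \<rho>" for x \<rho>
  proof (cases "\<rho> \<le> R \<and> near x \<rho> \<noteq> {}")
    case True
    then have "blk (x, \<rho>) \<in> near x \<rho>" by (intro blk_near) auto
    then show ?thesis by (auto simp: near_def)
  next
    case False
    then show ?thesis using that \<alpha> by (simp add: blk_far dist_norm)
  qed
  have move: "\<exists>b. bob_legal \<beta> X (x, \<rho>) (blk (x, \<rho>), \<alpha>) b" if x: "x \<in> X" and \<rho>: "0 < \<rho>" for x \<rho>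
  proof (cases "\<rho> \<le> R \<and> near x \<rho> \<noteq> {}")
    case True
    obtain x' where x': "x' \<in> X" "dist x x' \<le> \<rho> / 2" "\<rho> / 4 \<le> dist x' (blk (x, \<rho>))"
      using diffuse[OF x \<rho>] True by blast
    have "cball x' (\<rho> / 10) \<subseteq> cball x \<rho>"
      using x'(2) \<rho> by (subst cball_subset_cball_iff) (auto simp: dist_commute)
    moreover have "\<alpha> * \<rho> < \<rho> / 20" using \<alpha> \<rho> by (simp add: field_simps)
    then have "cball x' (\<rho> / 10) \<inter> cball (blk (x, \<rho>)) (\<alpha> * \<rho>) = {}"
      using x'(3) \<rho> by (intro disjoint_cballI) linarith
    ultimately have "bob_legal \<beta> X (x, \<rho>) (blk (x, \<rho>), \<alpha>) (x', \<rho> / 10)"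
      using x' \<rho> \<beta> by (auto simp: bob_legal_def)
    then show ?thesis ..
  next
    case False
    have "cball x ((1 - 2 * \<alpha>) * \<rho>) \<subseteq> cball x \<rho>" using \<alpha> \<rho> by (intro subset_cball) auto
    moreover have "cball x ((1 - 2 * \<alpha>) * \<rho>) \<inter> cball (blk (x, \<rho>)) (\<alpha> * \<rho>) = {}"
      using \<alpha> \<rho> by (intro disjoint_cballI) (simp add: blk_far[OF False] dist_norm algebra_simps)
    moreover have "\<beta> * \<rho> \<le> (1 - 2 * \<alpha>) * \<rho>" "(1 - 2 * \<alpha>) * \<rho> \<le> 1 * \<rho>"
      using \<alpha> \<beta> \<rho> by (auto intro!: mult_right_mono)
    ultimately have "bob_legal \<beta> X (x, \<rho>) (blk (x, \<rho>), \<alpha>) (x, (1 - 2 * \<alpha>) * \<rho>)"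
      using x by (auto simp: bob_legal_def)
    then show ?thesis ..
  qed
  have inv: "fst (B k) \<in> X \<and> 0 < snd (B k)" if "legal_upto \<beta> X \<sigma> B n" "k \<le> n" for B n k
    using that(2)
  proof (induction k)
    case 0
    then show ?case using that(1) by (simp add: legal_upto_def)
  next
    case (Suc k)
    then have "bob_legal \<beta> X (B k) (blk (B k), \<alpha>) (B (Suc k))"
      using that(1) unfolding legal_upto_def \<sigma> by (simp add: Suc_le_eq)
    then have "fst (B (Suc k)) \<in> X" "\<beta> * snd (B k) \<le> snd (B (Suc k))"
      by (auto simp: bob_legal_def split: prod.splits)
    moreover have "0 < \<beta> * snd (B k)" using Suc \<beta> by simp
    ultimately show ?case by simp
  qed
  have wins: "(\<Inter>k. cball (fst (B k)) (snd (B k))) \<inter> (Bad d \<inter> X) \<noteq> {}"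
    if legal: "\<And>n. legal_upto \<beta> X \<sigma> B n" for B
  proof -
    define x where "x k = fst (B k)" for k
    define r where "r k = snd (B k)" for k
    have xX: "x k \<in> X" and r0: "0 < r k" for k using inv[OF legal, of k k] by (auto simp: x_def r_def)
    have Bk: "B k = (x k, r k)" for k by (simp add: x_def r_def)
    have step: "bob_legal \<beta> X (x k, r k) (blk (x k, r k), \<alpha>) (x (Suc k), r (Suc k))" for k
      using legal[of "Suc k"] unfolding legal_upto_def \<sigma> Bk by simp
    have sub: "cball (x (Suc k)) (r (Suc k)) \<subseteq> cball (x k) (r k)"
      and avoid: "cball (x (Suc k)) (r (Suc k)) \<inter> cball (blk (x k, r k)) (\<alpha> * r k) = {}"
      and r_ge: "\<beta> * r k \<le> r (Suc k)" for k
      using step[of k] by (auto simp: bob_legal_def)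
    have "r (Suc k) \<le> (1 - 3 * \<alpha> / 8) * r k" for k
      by (rule bob_legal_shrinks[OF step r0 \<alpha>(1) r0 blk_dist[OF r0]])
    then have geo: "r k \<le> (1 - 3 * \<alpha> / 8) ^ k * r 0" for k
    proof (induction k)
      case (Suc k)
      have "r (Suc k) \<le> (1 - 3 * \<alpha> / 8) * r k" by (rule Suc)
      also have "\<dots> \<le> (1 - 3 * \<alpha> / 8) * ((1 - 3 * \<alpha> / 8) ^ k * r 0)"
        using Suc \<alpha> by (intro mult_left_mono) auto
      finally show ?case by (simp add: mult.assoc)
    qed simp
    have "(\<lambda>k. (1 - 3 * \<alpha> / 8) ^ k * r 0) \<longlonglongrightarrow> 0"
      using \<alpha> by (intro tendsto_mult_left_zero LIMSEQ_realpow_zero) auto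
    then have r_lim: "r \<longlonglongrightarrow> 0"
    proof (rule Lim_null_comparison[rotated])
      show "\<forall>\<^sub>F k in sequentially. norm (r k) \<le> (1 - 3 * \<alpha> / 8) ^ k * r 0"
        using geo r0 by (simp add: less_imp_le)
    qed
    have "\<Inter> (range (\<lambda>k. cball (x k) (r k))) \<noteq> {}"
    proof (rule compact_nest)
      show "cball (x k) (r k) \<noteq> {}" for k using r0[of k] by simp
      show "cball (x n) (r n) \<subseteq> cball (x m) (r m)" if "m \<le> n" for m n
        by (rule lift_Suc_antimono_le[of "\<lambda>k. cball (x k) (r k)", OF sub that])
    qed simp
    then obtain z where zI: "z \<in> (\<Inter>k. cball (x k) (r k))" by (meson equals0I)
    then have z: "z \<in> cball (x k) (r k)" for k by (rule INT_D) simp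
    have "(\<lambda>k. dist (x k) z) \<longlonglongrightarrow> 0"
    proof (rule Lim_null_comparison[OF _ r_lim])
      show "\<forall>\<^sub>F k in sequentially. norm (dist (x k) z) \<le> r k"
        using z by simp
    qed
    then have "x \<longlonglongrightarrow> z" by (rule tendsto_dist_iff[THEN iffD2])
    then have zX: "z \<in> X" by (rule closed_sequentially[OF X xX])
    \<comment> \<open>\<open>e / \<bar>q\<bar>\<^sup>2\<close> is a lower bound for the radius at the step where \<open>p / q\<close> is taken into account; the
      first term of the minimum covers fractions that matter from the start\<close>
    define e where "e = min (r 0) (\<beta> * min R (\<kappa> / 4))"
    have e: "e > 0" using r0 R \<beta> \<kappa> by (simp add: e_def)
    have "\<alpha> / 4 * e \<le> (cmod q)\<^sup>2 * dist z (p / q)" if pq: "p \<in> \<O> d" "q \<in> \<O> d" "q \<noteq> 0" for p q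
    proof -
      have q1: "1 \<le> (cmod q)\<^sup>2" using ring_of_integers_norm_ge_1[OF pq(2,3)] by simp
      define big where "big k \<longleftrightarrow> r k \<le> R \<and> 4 * r k * (cmod q)\<^sup>2 < \<kappa>" for k
      have "0 < min R (\<kappa> / (4 * (cmod q)\<^sup>2))" using R \<kappa> pq by simp
      then have "eventually (\<lambda>k. r k < min R (\<kappa> / (4 * (cmod q)\<^sup>2))) sequentially"
        by (rule order_tendstoD[OF r_lim])
      then obtain k0 where "r k0 < min R (\<kappa> / (4 * (cmod q)\<^sup>2))"
        by (auto simp: eventually_sequentially)
      then have "big k0" using q1 pq by (auto simp: big_def field_simps)
      define k where "k = (LEAST k. big k)"
      have k: "big k" using \<open>big k0\<close> by (simp add: k_def LeastI)
      have far: "\<alpha> / 4 * r k \<le> dist z (p / q)"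
      proof (cases "dist (x k) (p / q) \<le> (1 + \<alpha> / 4) * r k")
        case True
        then have pn: "p / q \<in> near (x k) (r k)" using k pq by (auto simp: near_def big_def)
        then have "blk (x k, r k) \<in> near (x k) (r k)" using k by (intro blk_near) (auto simp: big_def)
        then obtain p' q' where b: "blk (x k, r k) = p' / q'" and pq': "p' \<in> \<O> d" "q' \<in> \<O> d" "q' \<noteq> 0"
            "4 * r k * (cmod q')\<^sup>2 < \<kappa>" "dist (x k) (p' / q') \<le> (1 + \<alpha> / 4) * r k"
          by (auto simp: near_def)
        have "dist (p / q) (p' / q') \<le> 2 * ((1 + \<alpha> / 4) * r k)"
          using True pq'(5) dist_triangle3[of "p / q" "p' / q'" "x k"] by simp
        also have "\<dots> < 4 * r k" using \<alpha> r0[of k] by (simp add: field_simps)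
        finally have "p / q = p' / q'"
          using k pq pq' by (intro near_fractions_unique[OF d]) (auto simp: big_def \<kappa>_def)
        then have "\<alpha> * r k < dist (p / q) z" using avoid[of k] z[of "Suc k"] b by (simp add: disjoint_iff) (meson not_le)
        moreover have "\<alpha> / 4 * r k \<le> \<alpha> * r k" using \<alpha> r0[of k] by simp
        ultimately show ?thesis by (simp add: dist_commute)
      next
        case False
        then show ?thesis using z[of k] dist_triangle[of "x k" "p / q" z] by (simp add: algebra_simps)
      qed
      have "e \<le> (cmod q)\<^sup>2 * r k"
      proof (cases k)
        case 0
        have "1 * r 0 \<le> (cmod q)\<^sup>2 * r 0" using q1 r0[of 0] by (intro mult_right_mono) auto
        then show ?thesis by (simp add: 0 e_def)
      next
        case (Suc j)
        then have "\<not> big j" unfolding k_def using not_less_Least[of j big] by simp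
        then have "min R (\<kappa> / 4) \<le> (cmod q)\<^sup>2 * r j"
        proof (cases "r j \<le> R")
          case False
          have "1 * r j \<le> (cmod q)\<^sup>2 * r j" using q1 r0[of j] by (intro mult_right_mono) auto
          then show ?thesis using False by simp
        qed (simp add: big_def algebra_simps)
        then have "\<beta> * min R (\<kappa> / 4) \<le> \<beta> * ((cmod q)\<^sup>2 * r j)" using \<beta> by (intro mult_left_mono) auto
        also have "\<dots> = (cmod q)\<^sup>2 * (\<beta> * r j)" by simp
        also have "\<dots> \<le> (cmod q)\<^sup>2 * r k" unfolding Suc by (intro mult_left_mono r_ge) auto
        finally show ?thesis by (simp add: e_def)
      qed
      then have "\<alpha> / 4 * e \<le> \<alpha> / 4 * ((cmod q)\<^sup>2 * r k)" using \<alpha> by (intro mult_left_mono) auto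
      also have "\<dots> = (cmod q)\<^sup>2 * (\<alpha> / 4 * r k)" by simp
      also have "\<dots> \<le> (cmod q)\<^sup>2 * dist z (p / q)" by (intro mult_left_mono far) auto
      finally show ?thesis .
    qed
    moreover have "0 < \<alpha> / 4 * e" using \<alpha> e by simp
    ultimately have "z \<in> Bad d" unfolding Bad_iff by blast
    moreover have "z \<in> (\<Inter>k. cball (fst (B k)) (snd (B k)))" using zI unfolding x_def r_def .
    ultimately show ?thesis using zX by blast
  qed
  show "beta_absolute_winning \<beta> X (Bad d \<inter> X)"
    unfolding beta_absolute_winning_def
  proof (intro conjI exI[of _ \<sigma>] allI impI)
    fix B n assume l: "legal_upto \<beta> X \<sigma> B n"
    show "\<exists>b. bob_legal \<beta> X (B n) (\<sigma> (map B [0..<Suc n])) b"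
      using move[of "fst (B n)" "snd (B n)"] inv[OF l, of n] unfolding \<sigma> by simp
  next
    fix B assume "\<forall>n. legal_upto \<beta> X \<sigma> B n"
    then show "(\<Inter>k. cball (fst (B k)) (snd (B k))) \<inter> (Bad d \<inter> X) \<noteq> {}"
      by (intro wins) blast
  qed (use \<alpha> in \<open>simp_all add: \<sigma>_def\<close>)
qed

lemma Bad_absolute_winning_plane:
  assumes "d > 0" shows "absolute_winning (1 / 10) UNIV (Bad d)"
proof -
  have "\<exists>x'\<in>UNIV. dist x x' \<le> \<rho> / 2 \<and> \<rho> / 4 \<le> dist x' y" if "0 < \<rho>" for x y :: complex and \<rho>
  proof (cases "\<rho> / 4 \<le> dist x y")
    case True
    then show ?thesis using that by (intro bexI[of _ x]) auto
  next
    case False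
    have "\<rho> / 2 = dist (x + of_real (\<rho> / 2)) x" using that by (simp add: dist_norm)
    also have "\<dots> \<le> dist (x + of_real (\<rho> / 2)) y + dist x y" by (rule dist_triangle2)
    finally show ?thesis using False that
      by (intro bexI[of _ "x + of_real (\<rho> / 2)"]) (auto simp: dist_norm)
  qed
  then show ?thesis
    using Bad_absolute_winning_of_diffuse[OF assms closed_UNIV zero_less_one] by simp
qed

lemma dist_cis_bounds:
  assumes "\<bar>u - v\<bar> \<le> 1"
  shows "\<bar>u - v\<bar> / 2 \<le> dist (cis u) (cis v)" and "dist (cis u) (cis v) \<le> \<bar>u - v\<bar>"
proof -
  have "dist (cis u) (cis v) = dist (cis ((u - v) / 2 + (u + v) / 2)) (cis (- ((u - v) / 2) + (u + v) / 2))"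
    by (simp add: field_simps)
  also have "\<dots> = cmod ((cis ((u - v) / 2) - cis (- ((u - v) / 2))) * cis ((u + v) / 2))"
    by (simp add: dist_norm cis_mult algebra_simps)
  also have "\<dots> = cmod (2 * \<i> * sin ((u - v) / 2))"
    by (simp add: norm_mult) (simp add: cmod_def real_sqrt_mult)
  also have "\<dots> = 2 * \<bar>sin ((u - v) / 2)\<bar>" by (simp add: norm_mult)
  finally have eq: "dist (cis u) (cis v) = 2 * \<bar>sin ((u - v) / 2)\<bar>" .
  show "dist (cis u) (cis v) \<le> \<bar>u - v\<bar>"
    using abs_sin_x_le_abs_x[of "(u - v) / 2"] unfolding eq by simp
  define x where "x = \<bar>u - v\<bar> / 2"
  have x: "0 \<le> x" "x \<le> 1 / 2" using assms by (auto simp: x_def)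
  have "x / 2 \<le> sin x"
  proof (cases "x = 0")
    case False
    then have "x > 0" using x by simp
    then obtain z where z: "0 < z" "z < x" "sin x - sin 0 = (x - 0) * cos z"
      using MVT2[of 0 x sin cos] DERIV_sin by blast
    have "\<bar>sin (z / 2)\<bar>\<^sup>2 \<le> \<bar>z / 2\<bar>\<^sup>2" by (intro power_mono abs_sin_x_le_abs_x) auto
    moreover have "\<bar>z / 2\<bar>\<^sup>2 \<le> (1 / 4)\<^sup>2" using z x by (intro power_mono) auto
    moreover have "cos z = 1 - 2 * (sin (z / 2))\<^sup>2" using cos_double_sin[of "z / 2"] by simp
    ultimately have "1 / 2 \<le> cos z" by (simp add: power2_eq_square)
    then have "x * (1 / 2) \<le> x * cos z" using \<open>x > 0\<close> by (intro mult_left_mono) auto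
    then show ?thesis using z by simp
  qed simp
  also have "\<dots> = \<bar>sin ((u - v) / 2)\<bar>"
  proof -
    have "\<bar>sin ((u - v) / 2)\<bar> = \<bar>sin x\<bar>"
    proof -
      have "(u - v) / 2 = x \<or> (u - v) / 2 = - x" by (auto simp: x_def)
      then show ?thesis by auto
    qed
    moreover have "0 \<le> sin x" using \<open>x / 2 \<le> sin x\<close> x by linarith
    ultimately show ?thesis by simp
  qed
  finally show "\<bar>u - v\<bar> / 2 \<le> dist (cis u) (cis v)" unfolding eq by (simp add: x_def)
qed

text \<open>The points obtained from \<open>x\<close> by rotating through the angles \<open>\<rho> / (2 r)\<close> and \<open>- \<rho> / (2 r)\<close> are within \<open>\<rho> / 2\<close> of \<open>x\<close>
  and at least \<open>\<rho> / 2\<close> apart, so one of them is at distance at least \<open>\<rho> / 4\<close> from \<open>y\<close>.\<close>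

lemma Bad_absolute_winning_circle:
  assumes "d > 0" "0 < r" shows "absolute_winning (1 / 10) (sphere w r) (Bad d \<inter> sphere w r)"
proof (rule Bad_absolute_winning_of_diffuse[OF assms(1) closed_sphere assms(2)])
  fix x y \<rho> assume x: "x \<in> sphere w r" and \<rho>: "0 < \<rho>" "\<rho> \<le> r"
  define \<theta> where "\<theta> = \<rho> / (2 * r)"
  have \<theta>: "0 < \<theta>" "\<theta> \<le> 1 / 2" "r * \<theta> = \<rho> / 2" using \<rho> assms by (auto simp: \<theta>_def field_simps)
  define f where "f u = w + (x - w) * cis u" for u
  have cx: "cmod (x - w) = r" using x by (simp add: dist_norm norm_minus_commute)
  have fS: "f u \<in> sphere w r" for u by (simp add: f_def dist_norm norm_mult cx)
  have fd: "dist (f u) (f v) = r * dist (cis u) (cis v)" for u v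
  proof -
    have "f u - f v = (x - w) * (cis u - cis v)" by (simp add: f_def algebra_simps)
    then show ?thesis by (simp add: dist_norm norm_mult cx)
  qed
  have f0: "f 0 = x" by (simp add: f_def)
  have near: "dist x (f u) \<le> \<rho> / 2" if "\<bar>u\<bar> = \<theta>" for u
  proof -
    have "r * dist (cis 0) (cis u) \<le> r * \<bar>0 - u\<bar>"
      using that \<theta> assms by (intro mult_left_mono dist_cis_bounds) auto
    then show ?thesis using that \<theta>(3) fd[of 0 u] f0 by simp
  qed
  have "r * (\<bar>\<theta> - (- \<theta>)\<bar> / 2) \<le> r * dist (cis \<theta>) (cis (- \<theta>))"
    using \<theta> assms by (intro mult_left_mono dist_cis_bounds) auto
  then have "\<rho> / 2 \<le> dist (f \<theta>) (f (- \<theta>))" using \<theta> fd by simp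
  also have "\<dots> \<le> dist (f \<theta>) y + dist (f (- \<theta>)) y" by (rule dist_triangle2)
  finally have "\<rho> / 4 \<le> dist (f \<theta>) y \<or> \<rho> / 4 \<le> dist (f (- \<theta>)) y" by linarith
  then show "\<exists>x'\<in>sphere w r. dist x x' \<le> \<rho> / 2 \<and> \<rho> / 4 \<le> dist x' y"
    using near[of \<theta>] near[of "- \<theta>"] fS \<theta> by auto
qed

section \<open>Hausdorff dimension\<close>

lemma hausdorff_null_iff:
  "hausdorff_measure s A = 0 \<longleftrightarrow>
    (\<forall>\<delta>>0. \<forall>e>0. \<exists>U :: nat \<Rightarrow> 'a::metric_space set. A \<subseteq> (\<Union>i. U i) \<and>
      (\<forall>i. bounded (U i) \<and> diameter (U i) \<le> \<delta>) \<and> (\<Sum>i. ennreal (diameter (U i) powr s)) \<le> ennreal e)"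
    (is "_ = ?R")
proof
  assume L: "hausdorff_measure s A = 0"
  show ?R
  proof (intro allI impI)
    fix \<delta> e :: real assume \<delta>: "\<delta> > 0" and e: "e > 0"
    have "hausdorff_premeasure s \<delta> A \<le> hausdorff_measure s A"
      unfolding hausdorff_measure_def using \<delta> by (intro SUP_upper) auto
    then have "hausdorff_premeasure s \<delta> A < ennreal e" using L e by simp
    then show "\<exists>U. A \<subseteq> (\<Union>i. U i) \<and> (\<forall>i. bounded (U i) \<and> diameter (U i) \<le> \<delta>) \<and>
        (\<Sum>i. ennreal (diameter (U i) powr s)) \<le> ennreal e"
      unfolding hausdorff_premeasure_def INF_less_iff by (auto intro: less_imp_le)
  qed
next
  assume R: ?R
  have "hausdorff_premeasure s \<delta> A \<le> 0 + ennreal e" if "\<delta> > 0" "e > 0" for \<delta> e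
  proof -
    obtain U where U: "A \<subseteq> (\<Union>i. U i)" "\<forall>i. bounded (U i) \<and> diameter (U i) \<le> \<delta>"
      "(\<Sum>i. ennreal (diameter (U i) powr s)) \<le> ennreal e" using R[rule_format, OF \<open>\<delta> > 0\<close> \<open>e > 0\<close>] by blast
    have "U \<in> {U :: nat \<Rightarrow> 'a set. A \<subseteq> (\<Union>i. U i) \<and> (\<forall>i. bounded (U i) \<and> diameter (U i) \<le> \<delta>)}"
      using U(1,2) by (intro CollectI conjI)
    then have "hausdorff_premeasure s \<delta> A \<le> ennreal e"
      unfolding hausdorff_premeasure_def using U(3) by (rule INF_lower2[of U])
    then show ?thesis by simp
  qed
  note le = this
  have "hausdorff_premeasure s \<delta> A \<le> 0" if "\<delta> > 0" for \<delta>
  proof (rule ennreal_le_epsilon)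
    show "hausdorff_premeasure s \<delta> A \<le> 0 + ennreal e" if "0 < e" for e
      by (rule le[OF \<open>\<delta> > 0\<close> that])
  qed
  then show "hausdorff_measure s A = 0"
    unfolding hausdorff_measure_def by (metis SUP_least greaterThan_iff le_zero_eq)
qed

lemma hausdorff_null_subset:
  assumes "hausdorff_measure s B = 0" "A \<subseteq> B" shows "hausdorff_measure s A = 0"
  unfolding hausdorff_null_iff
proof (intro allI impI)
  fix \<delta> e :: real assume "\<delta> > 0" "e > 0"
  then obtain U where "B \<subseteq> (\<Union>i. U i)" "\<forall>i. bounded (U i) \<and> diameter (U i) \<le> \<delta>"
      "(\<Sum>i. ennreal (diameter (U i) powr s)) \<le> ennreal e"
    using assms(1)[unfolded hausdorff_null_iff, rule_format] by blast
  then show "\<exists>U. A \<subseteq> (\<Union>i. U i) \<and> (\<forall>i. bounded (U i) \<and> diameter (U i) \<le> \<delta>) \<and>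
      (\<Sum>i. ennreal (diameter (U i) powr s)) \<le> ennreal e"
    using assms(2) by (intro exI[of _ U]) auto
qed

text \<open>The \<open>n\<close>-th set is covered with total weight at most \<open>e / 2 ^ (n + 1)\<close>, and the double sequence of covering
  sets is arranged in a single one.\<close>

lemma hausdorff_null_UN:
  fixes A :: "nat \<Rightarrow> 'a::metric_space set"
  assumes "\<And>n. hausdorff_measure s (A n) = 0" shows "hausdorff_measure s (\<Union>n. A n) = 0"
  unfolding hausdorff_null_iff
proof (intro allI impI)
  fix \<delta> e :: real assume \<delta>: "\<delta> > 0" and e: "e > 0"
  have "\<forall>n. \<exists>U. A n \<subseteq> (\<Union>i::nat. U i) \<and> (\<forall>i. bounded (U i) \<and> diameter (U i) \<le> \<delta>) \<and>
      (\<Sum>i. ennreal (diameter (U i) powr s)) \<le> ennreal (e * (1 / 2) ^ Suc n)"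
    using assms \<delta> e unfolding hausdorff_null_iff by simp
  then obtain U where U: "\<And>n. A n \<subseteq> (\<Union>i::nat. U n i)" "\<And>n i. bounded (U n i)"
      "\<And>n i. diameter (U n i) \<le> \<delta>"
      "\<And>n. (\<Sum>i. ennreal (diameter (U n i) powr s)) \<le> ennreal (e * (1 / 2) ^ Suc n)"
    by metis
  define V where "V j = case_prod U (prod_decode j)" for j
  have "(\<Union>n. A n) \<subseteq> (\<Union>j. V j)"
  proof
    fix x assume "x \<in> (\<Union>n. A n)"
    then obtain n i where "x \<in> U n i" using U(1) by blast
    then have "x \<in> V (prod_encode (n, i))" by (simp add: V_def)
    then show "x \<in> (\<Union>j. V j)" by blast
  qed
  moreover have "bounded (V j) \<and> diameter (V j) \<le> \<delta>" for j
    using U(2,3) by (simp add: V_def split: prod.split)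
  moreover have "(\<Sum>j. ennreal (diameter (V j) powr s)) \<le> ennreal e"
  proof -
    define f where "f = (\<lambda>(n, i). ennreal (diameter (U n i) powr s))"
    have "ennreal (diameter (V j) powr s) = f (prod_decode j)" for j
      by (simp add: V_def f_def split: prod.split)
    then have "(\<Sum>j. ennreal (diameter (V j) powr s)) = (\<Sum>j. f (prod_decode j))" by simp
    also have "\<dots> = (\<Sum>n. \<Sum>i. ennreal (diameter (U n i) powr s))"
      by (rule suminf_ennreal_2dimen) (simp add: f_def)
    also have "\<dots> \<le> (\<Sum>n. ennreal (e * (1 / 2) ^ Suc n))"
    proof (rule suminf_le)
      show "(\<Sum>i. ennreal (diameter (U n i) powr s)) \<le> ennreal (e * (1 / 2) ^ Suc n)" for n
        by (rule U(4))
    qed (rule summableI)+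
    also have "\<dots> = ennreal (\<Sum>n. e * (1 / 2) ^ Suc n)"
      using e by (intro suminf_ennreal2 summable_mult sums_summable[OF power_half_series]) simp
    also have "(\<Sum>n. e * (1 / 2) ^ Suc n) = e * (\<Sum>n. (1 / 2) ^ Suc n)"
      by (rule suminf_mult[OF sums_summable[OF power_half_series]])
    also have "(\<Sum>n. (1 / 2) ^ Suc n) = (1 :: real)"
      by (rule sums_unique[OF power_half_series, symmetric])
    also have "e * 1 = e" by simp
    finally show ?thesis .
  qed
  ultimately show "\<exists>U. (\<Union>n. A n) \<subseteq> (\<Union>i. U i) \<and> (\<forall>i. bounded (U i) \<and> diameter (U i) \<le> \<delta>) \<and>
      (\<Sum>i. ennreal (diameter (U i) powr s)) \<le> ennreal e" by blast
qed

text \<open>A finite cover is padded with empty sets, which have diameter \<open>0\<close> and weight \<open>0 powr s = 0\<close>.\<close>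

lemma hausdorff_null_of_finite_covers:
  fixes A :: "'a::metric_space set"
  assumes "\<And>\<delta> e. \<delta> > 0 \<Longrightarrow> e > 0 \<Longrightarrow> \<exists>I (V :: 'i \<Rightarrow> 'a set). finite I \<and> A \<subseteq> (\<Union>i\<in>I. V i) \<and>
      (\<forall>i\<in>I. bounded (V i) \<and> diameter (V i) \<le> \<delta>) \<and> (\<Sum>i\<in>I. diameter (V i) powr s) \<le> e"
  shows "hausdorff_measure s A = 0"
  unfolding hausdorff_null_iff
proof (intro allI impI)
  fix \<delta> e :: real assume \<delta>: "\<delta> > 0" and e: "e > 0"
  obtain I and V :: "'i \<Rightarrow> 'a set" where V: "finite I" "A \<subseteq> (\<Union>i\<in>I. V i)"
      "\<forall>i\<in>I. bounded (V i) \<and> diameter (V i) \<le> \<delta>" "(\<Sum>i\<in>I. diameter (V i) powr s) \<le> e"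
    using assms[OF \<delta> e] by blast
  obtain f where f: "bij_betw f {..<card I} I"
    using V(1) ex_bij_betw_nat_finite[of I] by (auto simp: atLeast0LessThan)
  define U where "U n = (if n < card I then V (f n) else {})" for n
  have "A \<subseteq> (\<Union>n. U n)"
  proof
    fix x assume "x \<in> A"
    then obtain i where "i \<in> I" "x \<in> V i" using V(2) by blast
    moreover have "i \<in> f ` {..<card I}" using \<open>i \<in> I\<close> f by (simp add: bij_betw_def)
    then obtain n where "n < card I" "f n = i" by blast
    ultimately show "x \<in> (\<Union>n. U n)" by (auto simp: U_def)
  qed
  moreover have "bounded (U n) \<and> diameter (U n) \<le> \<delta>" for n
    using V(3) f \<delta> by (auto simp: U_def bij_betw_def)
  moreover have "(\<Sum>n. ennreal (diameter (U n) powr s)) \<le> ennreal e"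
  proof -
    have "(\<Sum>n. ennreal (diameter (U n) powr s)) = (\<Sum>n<card I. ennreal (diameter (U n) powr s))"
      by (intro suminf_finite) (auto simp: U_def)
    also have "\<dots> = ennreal (\<Sum>n<card I. diameter (V (f n)) powr s)"
      by (simp add: U_def)
    also have "(\<Sum>n<card I. diameter (V (f n)) powr s) = (\<Sum>i\<in>I. diameter (V i) powr s)"
      by (rule sum.reindex_bij_betw[OF f])
    finally show ?thesis using V(4) by (simp add: ennreal_leI)
  qed
  ultimately show "\<exists>U. A \<subseteq> (\<Union>i. U i) \<and> (\<forall>i. bounded (U i) \<and> diameter (U i) \<le> \<delta>) \<and>
      (\<Sum>i. ennreal (diameter (U i) powr s)) \<le> ennreal e" by blast
qed

lemma hausdorff_dim_ge:
  assumes "K \<subseteq> A" "\<And>s'. 0 < s' \<Longrightarrow> s' \<le> s \<Longrightarrow> hausdorff_measure s' K \<noteq> 0"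
  shows "ereal s \<le> hausdorff_dim A"
  unfolding hausdorff_dim_def
proof (rule Inf_greatest)
  fix x assume "x \<in> {ereal s' | s'. 0 < s' \<and> hausdorff_measure s' A = 0}"
  then obtain s' where s': "x = ereal s'" "0 < s'" "hausdorff_measure s' A = 0" by blast
  then have "\<not> s' \<le> s" using assms hausdorff_null_subset by blast
  then show "ereal s \<le> x" by (simp add: s')
qed

lemma hausdorff_dim_le:
  assumes "0 \<le> s" "\<And>s'. s < s' \<Longrightarrow> hausdorff_measure s' A = 0"
  shows "hausdorff_dim A \<le> ereal s"
proof (rule ereal_le_epsilon2)
  fix e :: real assume "0 < e"
  then have "hausdorff_dim A \<le> ereal (s + e)"
    unfolding hausdorff_dim_def using assms by (intro Inf_lower) auto
  then show "hausdorff_dim A \<le> ereal s + ereal e" by simp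
qed

lemma hausdorff_dim_mono: "A \<subseteq> B \<Longrightarrow> hausdorff_dim A \<le> hausdorff_dim B"
  unfolding hausdorff_dim_def by (intro Inf_superset_mono) (auto intro: hausdorff_null_subset)

section \<open>Grids in the plane\<close>

definition grid_box :: "nat \<Rightarrow> nat \<Rightarrow> int \<times> int \<Rightarrow> complex set" where
  "grid_box N k p = cbox (Complex (real_of_int (fst p) / real N ^ k) (real_of_int (snd p) / real N ^ k))
     (Complex ((real_of_int (fst p) + 1) / real N ^ k) ((real_of_int (snd p) + 1) / real N ^ k))"

text \<open>The two coordinates may be subdivided differently: \<open>M = N\<close> cuts a square into \<open>N\<^sup>2\<close> squares, while \<open>M = 1\<close>
  cuts only the first coordinate, as is appropriate for a curve.\<close>

definition grid_kids :: "nat \<Rightarrow> nat \<Rightarrow> int \<times> int \<Rightarrow> (int \<times> int) set" where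
  "grid_kids N M p = {int N * fst p..<int N * fst p + int N} \<times> {int M * snd p..<int M * snd p + int M}"

lemma mem_grid_box:
  "z \<in> grid_box N k p \<longleftrightarrow> real_of_int (fst p) / real N ^ k \<le> Re z \<and> Re z \<le> (real_of_int (fst p) + 1) / real N ^ k
     \<and> real_of_int (snd p) / real N ^ k \<le> Im z \<and> Im z \<le> (real_of_int (snd p) + 1) / real N ^ k"
  by (auto simp: grid_box_def in_cbox_complex_iff)

lemma grid_kids_finite_card [simp]: "finite (grid_kids N M p)" "card (grid_kids N M p) = N * M"
  by (simp_all add: grid_kids_def card_cartesian_product)

lemma grid_interval_nested:
  fixes a a' :: int
  assumes "N > 0" "int N * a \<le> a'" "a' < int N * a + int N"
  shows "real_of_int a / real N ^ k \<le> real_of_int a' / real N ^ Suc k" "(real_of_int a' + 1) / real N ^ Suc k \<le> (real_of_int a + 1) / real N ^ k"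
proof -
  have "real_of_int (int N * a) \<le> real_of_int a'" "real_of_int (a' + 1) \<le> real_of_int (int N * a + int N)"
    using assms by linarith+
  then have "real N * real_of_int a \<le> a'" "real_of_int a' + 1 \<le> real N * (real_of_int a + 1)" by (simp_all add: algebra_simps)
  then have "(real N * real_of_int a) / real N ^ Suc k \<le> real_of_int a' / real N ^ Suc k"
    "(real_of_int a' + 1) / real N ^ Suc k \<le> (real N * (real_of_int a + 1)) / real N ^ Suc k"
    by (intro divide_right_mono; simp)+
  moreover have "(real N * x) / real N ^ Suc k = x / real N ^ k" for x using assms(1) by simp
  ultimately show "real_of_int a / real N ^ k \<le> real_of_int a' / real N ^ Suc k" "(real_of_int a' + 1) / real N ^ Suc k \<le> (real_of_int a + 1) / real N ^ k"
    by metis+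
qed

lemma grid_interval_cover:
  fixes a :: int and x :: real
  assumes N: "N > 0" and x: "real_of_int a / real N ^ k \<le> x" "x \<le> (real_of_int a + 1) / real N ^ k"
  shows "\<exists>a'\<in>{int N * a..<int N * a + int N}. real_of_int a' / real N ^ Suc k \<le> x \<and> x \<le> (real_of_int a' + 1) / real N ^ Suc k"
proof -
  have y: "real N * real_of_int a \<le> x * real N ^ Suc k" "x * real N ^ Suc k \<le> real N * (real_of_int a + 1)"
  proof -
    have P: "real N ^ k > 0" using N by simp
    have "a \<le> x * real N ^ k" "x * real N ^ k \<le> real_of_int a + 1" using x P by (simp_all add: field_simps)
    then have "real N * real_of_int a \<le> real N * (x * real N ^ k)" "real N * (x * real N ^ k) \<le> real N * (real_of_int a + 1)"
      by (auto intro: mult_left_mono)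
    then show "real N * real_of_int a \<le> x * real N ^ Suc k" "x * real N ^ Suc k \<le> real N * (real_of_int a + 1)"
      by (simp_all add: mult.left_commute)
  qed
  define a' where "a' = min \<lfloor>x * real N ^ Suc k\<rfloor> (int N * a + int N - 1)"
  have "int N * a \<le> \<lfloor>x * real N ^ Suc k\<rfloor>" using y by (simp add: le_floor_iff)
  then have 1: "a' \<in> {int N * a..<int N * a + int N}" using N by (auto simp: a'_def)
  have "real_of_int a' \<le> x * real N ^ Suc k" unfolding a'_def by linarith
  then have 2: "real_of_int a' / real N ^ Suc k \<le> x" using N by (subst pos_divide_le_eq) auto
  have "x * real N ^ Suc k \<le> real_of_int a' + 1"
  proof (cases "\<lfloor>x * real N ^ Suc k\<rfloor> \<le> int N * a + int N - 1")
    case True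
    then show ?thesis unfolding a'_def by linarith
  next
    case False
    then have "a' + 1 = int N * (a + 1)" by (simp add: a'_def algebra_simps)
    then have "real_of_int (a' + 1) = real_of_int (int N * (a + 1))" by (rule arg_cong)
    then have "real_of_int a' + 1 = real N * (real_of_int a + 1)" by simp
    with y show ?thesis by simp
  qed
  then have 3: "x \<le> (real_of_int a' + 1) / real N ^ Suc k" using N by (subst pos_le_divide_eq) auto
  show ?thesis using 1 2 3 by blast
qed

lemma grid_box_nested:
  assumes "N > 0" "p' \<in> grid_kids N N p" shows "grid_box N (Suc k) p' \<subseteq> grid_box N k p"
proof -
  have "int N * fst p \<le> fst p'" "fst p' < int N * fst p + int N"
    "int N * snd p \<le> snd p'" "snd p' < int N * snd p + int N"
    using assms(2) by (auto simp: grid_kids_def)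
  note f = grid_interval_nested[OF assms(1) this(1,2), of k]
    and s = grid_interval_nested[OF assms(1) this(3,4), of k]
  show ?thesis
  proof
    fix z assume "z \<in> grid_box N (Suc k) p'"
    then have "real_of_int (fst p') / real N ^ Suc k \<le> Re z" "Re z \<le> (real_of_int (fst p') + 1) / real N ^ Suc k"
      "real_of_int (snd p') / real N ^ Suc k \<le> Im z" "Im z \<le> (real_of_int (snd p') + 1) / real N ^ Suc k"
      unfolding mem_grid_box by blast+
    then show "z \<in> grid_box N k p"
      unfolding mem_grid_box using f s by linarith
  qed
qed

lemma grid_box_cover:
  assumes "N > 0" "z \<in> grid_box N k p" shows "\<exists>p'\<in>grid_kids N N p. z \<in> grid_box N (Suc k) p'"
proof -
  obtain a where "a \<in> {int N * fst p..<int N * fst p + int N}" "real_of_int a / real N ^ Suc k \<le> Re z \<and> Re z \<le> (real_of_int a + 1) / real N ^ Suc k"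
    using grid_interval_cover[of N "fst p" k "Re z"] assms unfolding mem_grid_box by blast
  moreover obtain b where "b \<in> {int N * snd p..<int N * snd p + int N}" "real_of_int b / real N ^ Suc k \<le> Im z \<and> Im z \<le> (real_of_int b + 1) / real N ^ Suc k"
    using grid_interval_cover[of N "snd p" k "Im z"] assms unfolding mem_grid_box by blast
  ultimately show ?thesis
    by (intro bexI[of _ "(a, b)"]) (auto simp: mem_grid_box grid_kids_def)
qed

lemma grid_box_dist_le:
  assumes "x \<in> grid_box N k p" "y \<in> grid_box N k p" shows "dist x y \<le> 2 / N ^ k"
proof -
  have "\<bar>Re (x - y)\<bar> \<le> 1 / N ^ k" "\<bar>Im (x - y)\<bar> \<le> 1 / N ^ k"
    using assms by (auto simp: mem_grid_box add_divide_distrib)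
  then show ?thesis using cmod_le[of "x - y"] by (simp add: dist_norm)
qed

lemma bounded_grid_box: "bounded (grid_box N k p)"
  by (simp add: grid_box_def)

lemma grid_interval_nonempty: "N > 0 \<Longrightarrow> real_of_int a / real N ^ k \<le> (real_of_int a + 1) / real N ^ k"
  by (simp add: divide_right_mono)

text \<open>The left end points differ by at most \<open>4 + 1\<close> grid steps.\<close>

lemma grid_interval_close:
  fixes a b :: int
  assumes N: "N > 0" and x: "real_of_int a / real N ^ k \<le> x" "x \<le> (real_of_int a + 1) / real N ^ k"
    and y: "real_of_int b / real N ^ k \<le> y" "y \<le> (real_of_int b + 1) / real N ^ k" and d: "\<bar>x - y\<bar> \<le> 4 / real N ^ k"
  shows "\<bar>a - b\<bar> \<le> 5"
proof -
  have P: "real N ^ k > 0" using N by simp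
  have "a \<le> x * real N ^ k" "x * real N ^ k \<le> real_of_int a + 1" "b \<le> y * real N ^ k" "y * real N ^ k \<le> real_of_int b + 1"
    using x y P by (simp_all add: field_simps)
  moreover have "\<bar>x * real N ^ k - y * real N ^ k\<bar> \<le> 4"
  proof -
    have "\<bar>x * real N ^ k - y * real N ^ k\<bar> = \<bar>x - y\<bar> * real N ^ k"
      using P by (simp add: abs_mult flip: left_diff_distrib)
    then show ?thesis using d P by (simp add: pos_le_divide_eq)
  qed
  ultimately have "real_of_int a - real_of_int b \<le> 5" "real_of_int b - real_of_int a \<le> 5" by linarith+
  then show ?thesis by linarith
qed

section \<open>Cantor schemes and the mass distribution principle\<close>

primrec cantor_level :: "(nat \<Rightarrow> 'i \<Rightarrow> 'i set) \<Rightarrow> 'i \<Rightarrow> nat \<Rightarrow> 'i set" where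
  "cantor_level chl r 0 = {r}"
| "cantor_level chl r (Suc k) = (\<Union>p\<in>cantor_level chl r k. chl k p)"

text \<open>A tree of nested compact cells with exactly \<open>m\<close> children at each node; \<open>cell k p\<close> is the cell at position
  \<open>p\<close> of level \<open>k\<close>.\<close>

locale cantor_scheme =
  fixes cell :: "nat \<Rightarrow> 'i \<Rightarrow> 'a::heine_borel set" and chl :: "nat \<Rightarrow> 'i \<Rightarrow> 'i set" and root :: 'i and m :: nat
  assumes m_pos: "m > 0"
    and finite_chl: "p \<in> cantor_level chl root k \<Longrightarrow> finite (chl k p)"
    and card_chl: "p \<in> cantor_level chl root k \<Longrightarrow> card (chl k p) = m"
    and disjoint_chl: "p \<in> cantor_level chl root k \<Longrightarrow> p' \<in> cantor_level chl root k \<Longrightarrow> p \<noteq> p' \<Longrightarrow> chl k p \<inter> chl k p' = {}"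
    and compact_cell: "p \<in> cantor_level chl root k \<Longrightarrow> compact (cell k p)"
    and cell_nonempty: "p \<in> cantor_level chl root k \<Longrightarrow> cell k p \<noteq> {}"
    and cell_nested: "p \<in> cantor_level chl root k \<Longrightarrow> p' \<in> chl k p \<Longrightarrow> cell (Suc k) p' \<subseteq> cell k p"
begin

abbreviation "level \<equiv> cantor_level chl root"

definition stage :: "nat \<Rightarrow> 'a set" where "stage k = (\<Union>p\<in>level k. cell k p)"

definition limit_set :: "'a set" where "limit_set = (\<Inter>k. stage k)"

lemma finite_level: "finite (level k)"
  by (induction k) (auto intro: finite_chl)

lemma card_level: "card (level k) = m ^ k"
proof (induction k)
  case (Suc k)
  have "card (level (Suc k)) = (\<Sum>p\<in>level k. card (chl k p))"
    unfolding cantor_level.simps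
    by (rule card_UN_disjoint) (auto simp: finite_level finite_chl disjoint_chl)
  also have "\<dots> = (\<Sum>p\<in>level k. m)" by (intro sum.cong refl card_chl)
  finally show ?case using Suc by simp
qed simp

lemma level_nonempty: "level k \<noteq> {}"
  using card_level[of k] m_pos by force

lemma compact_stage: "compact (stage k)"
  unfolding stage_def by (intro compact_UN finite_level compact_cell)

lemma stage_nonempty: "stage k \<noteq> {}"
  using level_nonempty[of k] cell_nonempty[of _ k] unfolding stage_def by blast

lemma stage_antimono:
  assumes "j \<le> k" shows "stage k \<subseteq> stage j"
proof -
  have "stage (Suc i) \<subseteq> stage i" for i
    unfolding stage_def using cell_nested[of _ i] by fastforce
  then show ?thesis by (rule lift_Suc_antimono_le[of stage, OF _ assms])
qed

lemma limit_set_nonempty: "limit_set \<noteq> {}"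
  unfolding limit_set_def
  by (rule compact_nest) (auto simp: compact_stage stage_nonempty dest: stage_antimono)

lemma compact_limit_set: "compact limit_set"
  unfolding limit_set_def by (rule compact_Inter) (auto simp: compact_stage)

lemma limit_set_child:
  assumes "z \<in> limit_set"
  shows "\<exists>p\<in>level k. \<exists>p'\<in>chl k p. z \<in> cell (Suc k) p'"
proof -
  have "z \<in> stage (Suc k)" using assms by (simp add: limit_set_def)
  then show ?thesis by (auto simp: stage_def)
qed

lemma stage_subset_open:
  assumes "open W" "limit_set \<subseteq> W" shows "\<exists>k. stage k \<subseteq> W"
proof (rule ccontr)
  assume "\<nexists>k. stage k \<subseteq> W"
  then have "stage k - W \<noteq> {}" for k by blast
  then have "(\<Inter>k. stage k - W) \<noteq> {}"
    using assms(1) by (intro compact_nest) (auto intro: compact_diff compact_stage dest: stage_antimono)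
  then show False using assms(2) by (auto simp: limit_set_def)
qed

text \<open>A cell meeting \<open>V\<close> descends only from cells meeting \<open>V\<close>. This replaces the comparison of \<open>V\<close> with the
  uniform measure on the limit set.\<close>

lemma card_descendants_meeting:
  "card {p \<in> level (k + j). cell (k + j) p \<inter> V \<noteq> {}} \<le> card {p \<in> level k. cell k p \<inter> V \<noteq> {}} * m ^ j"
proof (induction j)
  case (Suc j)
  let ?S = "{p \<in> level (k + j). cell (k + j) p \<inter> V \<noteq> {}}"
  have fin: "finite ?S" by (simp add: finite_level)
  have "{p \<in> level (k + Suc j). cell (k + Suc j) p \<inter> V \<noteq> {}} \<subseteq> (\<Union>p\<in>?S. chl (k + j) p)"
    using cell_nested[of _ "k + j"] by fastforce
  then have "card {p \<in> level (k + Suc j). cell (k + Suc j) p \<inter> V \<noteq> {}} \<le> card (\<Union>p\<in>?S. chl (k + j) p)"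
    by (intro card_mono finite_UN_I fin) (auto intro: finite_chl)
  also have "\<dots> \<le> (\<Sum>p\<in>?S. card (chl (k + j) p))" by (rule card_UN_le[OF fin])
  also have "\<dots> = (\<Sum>p\<in>?S. m)" by (intro sum.cong refl card_chl) auto
  also have "\<dots> = card ?S * m" by simp
  also have "\<dots> \<le> card {p \<in> level k. cell k p \<inter> V \<noteq> {}} * m ^ j * m" by (intro mult_right_mono Suc) simp
  finally show ?case by (simp add: mult_ac)
qed simp

text \<open>The mass distribution principle, by counting. Suppose the limit set has covers of arbitrarily small weight. Enlarge
  the covering sets slightly to open sets \<open>V i\<close>; by compactness finitely many of them already cover a whole
  stage \<open>k\<close> of the construction. A set of size about \<open>\<rho> / N ^ h\<close> meets at most \<open>M\<close> cells of level \<open>h\<close>, hence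
  at most \<open>M m ^ (k - h)\<close> of the \<open>m ^ k\<close> cells of level \<open>k\<close>, and \<open>1 / m ^ h\<close> is at most a constant times
  the \<open>s\<close>-th power of the size because \<open>N powr s \<le> m\<close>. Adding up gives \<open>1 \<le> C \<Sum> w i powr s\<close>, a
  positive lower bound for the weight of the cover.\<close>

lemma limit_set_not_null:
  fixes N s \<rho> :: real and M :: nat
  assumes N: "N > 1" and \<rho>: "\<rho> > 0" and s: "s > 0" and m: "N powr s \<le> m" and M: "M > 0"
    and multiplicity: "\<And>k V. (\<And>x y. x \<in> V \<Longrightarrow> y \<in> V \<Longrightarrow> dist x y < \<rho> / N ^ k) \<Longrightarrow>
      card {p \<in> level k. cell k p \<inter> V \<noteq> {}} \<le> M"
  shows "hausdorff_measure s limit_set \<noteq> 0"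
proof
  assume null: "hausdorff_measure s limit_set = 0"
  define C where "C = M * (N / \<rho>) powr s"
  have C: "C > 0" using N \<rho> M by (simp add: C_def)
  define e where "e = 1 / (4 * C)"
  have e: "e > 0" using C by (simp add: e_def)
  have "\<rho> / 2 > 0" using \<rho> by simp
  then obtain U :: "nat \<Rightarrow> 'a set" where U: "limit_set \<subseteq> (\<Union>i. U i)"
      "\<And>i. bounded (U i)" "\<And>i. diameter (U i) \<le> \<rho> / 2" "(\<Sum>i. ennreal (diameter (U i) powr s)) \<le> ennreal e"
    using null[unfolded hausdorff_null_iff, rule_format, of "\<rho> / 2" e] e by blast
  have "\<exists>w. diameter (U i) < w \<and> w < \<rho> \<and> w powr s < diameter (U i) powr s + e * (1 / 2) ^ Suc i" for i
  proof -
    let ?x = "diameter (U i)"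
    have x0: "0 \<le> ?x" by (rule diameter_ge_0[OF U(2)])
    have "continuous_on {0..} (\<lambda>w. w powr s)"
      using s by (intro continuous_on_powr') (auto intro: continuous_on_id continuous_on_const)
    then have "continuous (at ?x within {0..}) (\<lambda>w. w powr s)"
      using x0 by (simp add: continuous_on_eq_continuous_within)
    then have "((\<lambda>w. w powr s) \<longlongrightarrow> ?x powr s) (at ?x within {0..})"
      by (simp add: continuous_within)
    then have "((\<lambda>w. w powr s) \<longlongrightarrow> ?x powr s) (at_right ?x)"
      by (rule tendsto_within_subset) (use x0 in auto)
    moreover have "?x powr s < ?x powr s + e * (1 / 2) ^ Suc i" using e by simp
    ultimately have "eventually (\<lambda>w. w powr s < ?x powr s + e * (1 / 2) ^ Suc i) (at_right ?x)"
      by (rule order_tendstoD)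
    moreover have "?x < \<rho>" using U(3)[of i] \<rho> by simp
    then have "eventually (\<lambda>w. w \<in> {?x<..<\<rho>}) (at_right ?x)" by (rule eventually_at_right_real)
    ultimately have "eventually (\<lambda>w. ?x < w \<and> w < \<rho> \<and> w powr s < ?x powr s + e * (1 / 2) ^ Suc i) (at_right ?x)"
      by eventually_elim auto
    then show ?thesis by (rule eventually_happens'[rotated]) simp
  qed
  \<comment> \<open>the sizes of the enlarged sets, which are positive even where the diameter vanishes\<close>
  then obtain w where w: "\<And>i. diameter (U i) < w i" "\<And>i. w i < \<rho>"
      "\<And>i. w i powr s < diameter (U i) powr s + e * (1 / 2) ^ Suc i" by metis
  have w0: "0 < w i" for i using diameter_ge_0[OF U(2), of i] w(1)[of i] by linarith
  define V where "V i = (\<Union>x\<in>U i. ball x ((w i - diameter (U i)) / 2))" for i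
  have UV: "U i \<subseteq> V i" for i using w(1)[of i] by (force simp: V_def)
  have openV: "open (V i)" for i by (auto simp: V_def)
  have distV: "dist x y < w i" if xy: "x \<in> V i" "y \<in> V i" for x y i
  proof -
    obtain u v where u: "u \<in> U i" "dist u x < (w i - diameter (U i)) / 2"
        and v: "v \<in> U i" "dist v y < (w i - diameter (U i)) / 2"
      using xy unfolding V_def UN_iff mem_ball by blast
    have "dist x y \<le> dist u x + dist u v + dist v y"
      using dist_triangle[of x y u] dist_triangle[of u y v] by (simp add: dist_commute)
    also have "\<dots> < (w i - diameter (U i)) / 2 + diameter (U i) + (w i - diameter (U i)) / 2"
      by (intro add_strict_mono add_less_le_mono u v diameter_bounded_bound[OF U(2) u(1) v(1)])
    also have "\<dots> = w i" by (simp add: field_simps)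
    finally show ?thesis .
  qed
  \<comment> \<open>the scale of the cells matching the size of a covering set\<close>
  define h where "h i = (LEAST k. \<rho> / N ^ Suc k \<le> w i)" for i
  have h: "\<rho> / N ^ Suc (h i) \<le> w i" "w i < \<rho> / N ^ h i" for i
  proof -
    have "\<exists>k. \<rho> / w i < N ^ k" by (rule real_arch_pow[OF N])
    then obtain k where "\<rho> / w i < N ^ k" ..
    moreover have "N ^ k \<le> N ^ Suc k" using N by (intro power_increasing) auto
    ultimately have "\<rho> / w i < N ^ Suc k" by (rule less_le_trans)
    then have "\<rho> < N ^ Suc k * w i" by (simp only: pos_divide_less_eq[OF w0])
    moreover have "0 < N ^ Suc k" using N by simp
    ultimately have "\<rho> / N ^ Suc k \<le> w i" by (simp only: pos_divide_le_eq mult.commute less_imp_le)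
    then show "\<rho> / N ^ Suc (h i) \<le> w i" unfolding h_def by (rule LeastI)
    show "w i < \<rho> / N ^ h i"
    proof (cases "h i")
      case 0
      then show ?thesis using w(2) by simp
    next
      case (Suc j)
      then have "\<not> \<rho> / N ^ Suc j \<le> w i" using not_less_Least[of j "\<lambda>k. \<rho> / N ^ Suc k \<le> w i"] by (simp add: h_def)
      then show ?thesis using Suc by simp
    qed
  qed
  have weight: "(1 / real m) ^ h i \<le> (N / \<rho>) powr s * w i powr s" for i
  proof -
    have "0 < N powr s" using N by simp
    then have "1 / real m \<le> 1 / N powr s" using m m_pos by (intro divide_left_mono mult_pos_pos) auto
    then have "(1 / real m) ^ h i \<le> (1 / N powr s) ^ h i" by (intro power_mono) auto
    also have "\<dots> = 1 / (N powr s) ^ h i" by (simp add: power_one_over)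
    also have "(N powr s) ^ h i = (N powr real (h i)) powr s"
      using N by (simp add: powr_power powr_powr mult.commute)
    also have "\<dots> = (N ^ h i) powr s" using N by (simp add: powr_realpow)
    also have "1 / \<dots> = (1 / N ^ h i) powr s" using N by (simp add: powr_divide)
    also have "\<dots> \<le> (N / \<rho> * w i) powr s"
      using h(1)[of i] N \<rho> s by (intro powr_mono2) (auto simp: field_simps)
    also have "\<dots> = (N / \<rho>) powr s * w i powr s" by (rule powr_mult)
    finally show ?thesis .
  qed
  obtain I where I: "finite I" "limit_set \<subseteq> (\<Union>i\<in>I. V i)"
  proof -
    have sub: "limit_set \<subseteq> (\<Union>i. V i)" using U(1) UV by blast
    show ?thesis
      by (rule compactE_image[OF compact_limit_set openV sub]) (rule that)
  qed
  have "open (\<Union>i\<in>I. V i)" using openV by blast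
  then obtain k0 where k0: "stage k0 \<subseteq> (\<Union>i\<in>I. V i)" using stage_subset_open I(2) by blast
  define k where "k = Max (insert k0 (h ` I))"
  have kk: "k0 \<le> k" "\<And>i. i \<in> I \<Longrightarrow> h i \<le> k" using I(1) by (auto simp: k_def)
  have cover: "stage k \<subseteq> (\<Union>i\<in>I. V i)" using k0 stage_antimono[OF kk(1)] by blast
  let ?S = "\<lambda>i. {p \<in> level k. cell k p \<inter> V i \<noteq> {}}"
  have card_S: "real (card (?S i)) \<le> M * ((1 / real m) ^ h i * m ^ k)" if i: "i \<in> I" for i
  proof -
    have "card {p \<in> level (h i). cell (h i) p \<inter> V i \<noteq> {}} \<le> M"
      by (rule multiplicity) (use distV h(2)[of i] in \<open>meson less_trans\<close>)
    then have "card {p \<in> level (h i). cell (h i) p \<inter> V i \<noteq> {}} * m ^ (k - h i) \<le> M * m ^ (k - h i)"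
      by (rule mult_le_mono1)
    moreover have "h i + (k - h i) = k" using kk(2)[OF i] by simp
    then have "card (?S i) \<le> card {p \<in> level (h i). cell (h i) p \<inter> V i \<noteq> {}} * m ^ (k - h i)"
      using card_descendants_meeting[of "h i" "k - h i" "V i"] by simp
    ultimately have "card (?S i) \<le> M * m ^ (k - h i)" by (rule order_trans[rotated])
    then have "real (card (?S i)) \<le> real (M * m ^ (k - h i))" by (rule of_nat_mono)
    also have "\<dots> = real M * real m ^ (k - h i)" by simp
    also have "real m ^ (k - h i) = (1 / real m) ^ h i * m ^ k"
      using m_pos kk(2)[OF i] by (simp add: power_diff field_simps)
    finally show ?thesis .
  qed
  have "level k \<subseteq> (\<Union>i\<in>I. ?S i)"
  proof
    fix p assume p: "p \<in> level k"
    then obtain x where "x \<in> cell k p" using cell_nonempty by blast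
    moreover from this have "x \<in> (\<Union>i\<in>I. V i)" using cover p unfolding stage_def by blast
    ultimately show "p \<in> (\<Union>i\<in>I. ?S i)" using p by blast
  qed
  then have "card (level k) \<le> card (\<Union>i\<in>I. ?S i)"
    using I(1) finite_level by (intro card_mono) auto
  also have "\<dots> \<le> (\<Sum>i\<in>I. card (?S i))" by (rule card_UN_le[OF I(1)])
  finally have "real (m ^ k) \<le> real (\<Sum>i\<in>I. card (?S i))" unfolding card_level by (rule of_nat_mono)
  also have "\<dots> = (\<Sum>i\<in>I. real (card (?S i)))" by (rule of_nat_sum)
  also have "\<dots> \<le> (\<Sum>i\<in>I. M * ((1 / real m) ^ h i * m ^ k))" by (intro sum_mono card_S)
  also have "\<dots> \<le> (\<Sum>i\<in>I. M * (((N / \<rho>) powr s * w i powr s) * m ^ k))"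
    by (intro sum_mono mult_left_mono mult_right_mono weight) auto
  also have "\<dots> = C * (\<Sum>i\<in>I. w i powr s) * m ^ k"
    by (simp add: C_def sum_distrib_left sum_distrib_right mult_ac)
  finally have "1 \<le> C * (\<Sum>i\<in>I. w i powr s)" using m_pos by simp
  moreover have "(\<Sum>i\<in>I. w i powr s) \<le> e + e"
  proof -
    have "(\<Sum>i\<in>I. w i powr s) \<le> (\<Sum>i\<in>I. diameter (U i) powr s + e * (1 / 2) ^ Suc i)"
      by (intro sum_mono less_imp_le w(3))
    also have "\<dots> = (\<Sum>i\<in>I. diameter (U i) powr s) + e * (\<Sum>i\<in>I. (1 / 2) ^ Suc i)"
      by (simp only: sum.distrib sum_distrib_left)
    also have "\<dots> \<le> e + e * 1"
    proof (intro add_mono mult_left_mono)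
      have "ennreal (\<Sum>i\<in>I. diameter (U i) powr s) = (\<Sum>i\<in>I. ennreal (diameter (U i) powr s))"
        by simp
      also have "\<dots> \<le> (\<Sum>i. ennreal (diameter (U i) powr s))"
        by (rule sum_le_suminf[OF summableI I(1)]) simp
      finally have "ennreal (\<Sum>i\<in>I. diameter (U i) powr s) \<le> ennreal e" using U(4) by (rule order_trans)
      then show "(\<Sum>i\<in>I. diameter (U i) powr s) \<le> e" using e by simp
      have "(\<Sum>i\<in>I. (1 / 2 :: real) ^ Suc i) \<le> (\<Sum>i. (1 / 2) ^ Suc i)"
        by (rule sum_le_suminf[OF sums_summable[OF power_half_series] I(1)]) simp
      also have "\<dots> = 1" by (rule sums_unique[OF power_half_series, symmetric])
      finally show "(\<Sum>i\<in>I. (1 / 2 :: real) ^ Suc i) \<le> 1" .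
    qed (use e in simp)
    finally show ?thesis by simp
  qed
  then have "C * (\<Sum>i\<in>I. w i powr s) \<le> C * (e + e)" using C by (intro mult_left_mono) auto
  moreover have "C * (e + e) = 1 / 2" using C by (simp add: e_def)
  ultimately show False by linarith
qed

end

section \<open>Cantor sets of badly approximable numbers\<close>

definition grid_range :: "nat \<Rightarrow> nat \<Rightarrow> nat \<Rightarrow> (int \<times> int) set" where
  "grid_range N M k = {0..<int N ^ k} \<times> {0..<int M ^ k}"

lemma grid_kids_range:
  assumes "p \<in> grid_range N M k" shows "grid_kids N M p \<subseteq> grid_range N M (Suc k)"
proof -
  have step: "0 \<le> a' \<and> a' < int L ^ Suc k"
    if "0 \<le> a" "a < int L ^ k" "int L * a \<le> a'" "a' < int L * a + int L" for a a' L
  proof -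
    have "int L * (a + 1) \<le> int L * int L ^ k" using that by (intro mult_left_mono) auto
    then have "int L * a + int L \<le> int L ^ Suc k" by (simp add: algebra_simps)
    moreover have "0 \<le> int L * a" using that by simp
    ultimately show ?thesis using that(3,4) by linarith
  qed
  show ?thesis
    using assms step unfolding grid_range_def grid_kids_def by (auto simp del: power_Suc)
qed

lemma grid_kids_disjoint:
  assumes "p \<noteq> p'" shows "grid_kids N M p \<inter> grid_kids N M p' = {}"
proof -
  have same: "a = b" if "int L * a \<le> x" "x < int L * a + int L" "int L * b \<le> x" "x < int L * b + int L" for a b x L
  proof -
    have "int L * a < int L * (b + 1)" "int L * b < int L * (a + 1)" using that by (auto simp: algebra_simps)
    moreover have "0 < int L" using that by linarith
    ultimately have "a < b + 1" "b < a + 1" by (auto simp: mult_less_cancel_left_pos)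
    then show ?thesis by simp
  qed
  show ?thesis
  proof (rule ccontr)
    assume "grid_kids N M p \<inter> grid_kids N M p' \<noteq> {}"
    then obtain x y where xy: "(x, y) \<in> grid_kids N M p" "(x, y) \<in> grid_kids N M p'" by auto
    have "fst p = fst p'" by (rule same[of N _ x]) (use xy in \<open>auto simp: grid_kids_def\<close>)
    moreover have "snd p = snd p'" by (rule same[of M _ y]) (use xy in \<open>auto simp: grid_kids_def\<close>)
    ultimately show False using assms by (simp add: prod_eq_iff)
  qed
qed

text \<open>In both applications two cells of a level that come within two cell lengths of each other are related in this way; a
  set of pairwise related positions has at most \<open>11\<^sup>2 = 121\<close> elements.\<close>

definition grid_near :: "int \<times> int \<Rightarrow> int \<times> int \<Rightarrow> bool" where
  "grid_near p p' \<longleftrightarrow> \<bar>fst p - fst p'\<bar> \<le> 5 \<and> \<bar>snd p - snd p'\<bar> \<le> 5"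

lemma card_grid_near:
  assumes "\<And>p p'. p \<in> S \<Longrightarrow> p' \<in> S \<Longrightarrow> grid_near p p'" shows "finite S" "card S \<le> 121"
proof -
  have "finite S \<and> card S \<le> 121"
  proof (cases "S = {}")
    case False
    then obtain q where q: "q \<in> S" by blast
    let ?B = "{fst q - 5..fst q + 5} \<times> {snd q - 5..snd q + 5}"
    have "S \<subseteq> ?B" using assms[OF _ q] by (force simp: grid_near_def)
    moreover have "finite ?B" "card ?B = 121" by (simp_all add: card_cartesian_product)
    ultimately show ?thesis by (metis card_mono finite_subset)
  qed simp
  then show "finite S" "card S \<le> 121" by auto
qed

text \<open>A system of cells indexed by the grid that is metrically comparable with the grid; \<open>\<rho>\<close> is the size of the
  root cell. The instances are the squares in the unit square and the arcs of a circular arc.\<close>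

locale grid_cells =
  fixes N M :: nat and \<rho> :: real and cell :: "nat \<Rightarrow> int \<times> int \<Rightarrow> complex set"
  assumes N: "2 \<le> N" and M: "0 < M" and \<rho>: "0 < \<rho>"
    and compact_cell: "p \<in> grid_range N M k \<Longrightarrow> compact (cell k p)"
    and cell_nonempty: "p \<in> grid_range N M k \<Longrightarrow> cell k p \<noteq> {}"
    and cell_nested: "p \<in> grid_range N M k \<Longrightarrow> p' \<in> grid_kids N M p \<Longrightarrow> cell (Suc k) p' \<subseteq> cell k p"
    and cell_dist: "p \<in> grid_range N M k \<Longrightarrow> x \<in> cell k p \<Longrightarrow> y \<in> cell k p \<Longrightarrow> dist x y \<le> 2 * \<rho> / N ^ k"
    and cell_near: "p \<in> grid_range N M k \<Longrightarrow> p' \<in> grid_range N M k \<Longrightarrow> x \<in> cell k p \<Longrightarrow> y \<in> cell k p' \<Longrightarrow>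
      dist x y \<le> 2 * \<rho> / N ^ k \<Longrightarrow> grid_near p p'"
begin

text \<open>Each cell has \<open>N * M\<close> children. At most \<open>121\<close> of them are forbidden, so \<open>m\<close> admissible ones can be selected,
  which makes the surviving cells a Cantor scheme.\<close>

lemma cantor_set_avoiding:
  fixes bad :: "nat \<Rightarrow> int \<times> int \<Rightarrow> (int \<times> int) set"
  assumes bad: "\<And>k p. p \<in> grid_range N M k \<Longrightarrow> card (bad k p \<inter> grid_kids N M p) \<le> 121"
    and m: "0 < m" "m + 121 \<le> N * M" "real N powr s \<le> m"
  obtains K where "K \<noteq> {}" "K \<subseteq> cell 0 (0, 0)"
    "\<And>s'. 0 < s' \<Longrightarrow> s' \<le> s \<Longrightarrow> hausdorff_measure s' K \<noteq> 0"
    "\<And>z k. z \<in> K \<Longrightarrow> \<exists>p\<in>grid_range N M k. \<exists>p'\<in>grid_kids N M p - bad k p. z \<in> cell (Suc k) p'"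
proof -
  have "\<forall>k p. \<exists>C. C \<subseteq> grid_kids N M p - bad k p \<and> (p \<in> grid_range N M k \<longrightarrow> card C = m)"
  proof (intro allI)
    fix k p show "\<exists>C. C \<subseteq> grid_kids N M p - bad k p \<and> (p \<in> grid_range N M k \<longrightarrow> card C = m)"
  proof (cases "p \<in> grid_range N M k")
    case True
    have "grid_kids N M p - bad k p = grid_kids N M p - (bad k p \<inter> grid_kids N M p)" by blast
    then have "card (grid_kids N M p - bad k p) \<ge> N * M - 121"
      using bad[OF True] by (simp add: card_Diff_subset)
    then have "m \<le> card (grid_kids N M p - bad k p)" using m(2) by linarith
    then show ?thesis by (meson obtain_subset_with_card_n)
  qed blast
  qed
  then obtain chl where chl: "\<And>k p. chl k p \<subseteq> grid_kids N M p - bad k p"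
      "\<And>k p. p \<in> grid_range N M k \<Longrightarrow> card (chl k p) = m" by metis
  have range: "cantor_level chl (0, 0) k \<subseteq> grid_range N M k" for k
  proof (induction k)
    case 0
    then show ?case by (simp add: grid_range_def)
  next
    case (Suc k)
    show ?case
    proof
      fix p' assume "p' \<in> cantor_level chl (0, 0) (Suc k)"
      then obtain p where p: "p \<in> cantor_level chl (0, 0) k" "p' \<in> chl k p" by auto
      then have "p \<in> grid_range N M k" using Suc by blast
      then show "p' \<in> grid_range N M (Suc k)" using grid_kids_range chl(1) p(2) by blast
    qed
  qed
  interpret cantor_scheme cell chl "(0, 0)" m
  proof
    show "finite (chl k p)" for k p
      by (rule finite_subset[OF subset_trans[OF chl(1) Diff_subset]]) simp
    show "chl k p \<inter> chl k p' = {}" if "p \<noteq> p'" for k p p'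
      using grid_kids_disjoint[OF that, of N M] chl(1)[of k] by blast
    show "cell (Suc k) p' \<subseteq> cell k p" if "p \<in> cantor_level chl (0, 0) k" "p' \<in> chl k p" for k p p'
      by (rule cell_nested) (use that range chl(1) in blast)+
    show "card (chl k p) = m" if "p \<in> cantor_level chl (0, 0) k" for k p
      by (rule chl(2)) (use that range in blast)
    show "compact (cell k p)" if "p \<in> cantor_level chl (0, 0) k" for k p
      by (rule compact_cell) (use that range in blast)
    show "cell k p \<noteq> {}" if "p \<in> cantor_level chl (0, 0) k" for k p
      by (rule cell_nonempty) (use that range in blast)
  qed (rule m)
  show ?thesis
  proof (rule that[of limit_set])
    show "limit_set \<noteq> {}" by (rule limit_set_nonempty)
    have "stage 0 = cell 0 (0, 0)" by (simp add: stage_def)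
    then show "limit_set \<subseteq> cell 0 (0, 0)" unfolding limit_set_def by blast
    show "hausdorff_measure s' limit_set \<noteq> 0" if s': "0 < s'" "s' \<le> s" for s'
    proof (rule limit_set_not_null[where N = "real N" and \<rho> = \<rho> and M = 121])
      have "real N powr s' \<le> real N powr s" using N s' by (intro powr_mono) auto
      then show "real N powr s' \<le> real m" using m(3) by simp
      show "card {p \<in> level k. cell k p \<inter> V \<noteq> {}} \<le> 121"
        if V: "\<And>x y. x \<in> V \<Longrightarrow> y \<in> V \<Longrightarrow> dist x y < \<rho> / real N ^ k" for k V
      proof (rule card_grid_near)
        fix p p' assume "p \<in> {p \<in> level k. cell k p \<inter> V \<noteq> {}}" "p' \<in> {p \<in> level k. cell k p \<inter> V \<noteq> {}}"
        then obtain x y where x: "p \<in> level k" "x \<in> cell k p" "x \<in> V"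
          and y: "p' \<in> level k" "y \<in> cell k p'" "y \<in> V" by blast
        have "dist x y \<le> \<rho> / real N ^ k" using V[OF x(3) y(3)] by simp
        also have "\<dots> \<le> 2 * \<rho> / real N ^ k" using \<rho> by (intro divide_right_mono) auto
        finally have "dist x y \<le> 2 * \<rho> / real (N ^ k)" by simp
        then show "grid_near p p'" using x y range by (intro cell_near[of p k p' x y]) auto
      qed
    qed (use N \<rho> s' in auto)
    show "\<exists>p\<in>grid_range N M k. \<exists>p'\<in>grid_kids N M p - bad k p. z \<in> cell (Suc k) p'"
      if "z \<in> limit_set" for z k
      using limit_set_child[OF that, of k] range chl(1) by blast
  qed
qed

text \<open>At step \<open>k\<close> the construction takes care of the fractions with
  \<open>X k \<le> \<bar>q\<bar>\<^sup>2 < X (k + 1)\<close>, where \<open>X k\<close> is chosen such that \<open>X (k + 1) = \<kappa> / (4 \<rho> / N ^ k)\<close>.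
  The upper bound on \<open>\<bar>q\<bar>\<^sup>2\<close> means that at most one such fraction comes near a given cell of level \<open>k\<close>; the
  lower bound together with \<open>4 N\<^sup>2 c \<le> \<kappa>\<close> means that its forbidden disc has radius at most
  \<open>\<rho> / N ^ (k + 1)\<close>, the size of a child. So the children touched by the disc are pairwise near each
  other, and there are at most \<open>121\<close> of them. The fractions with \<open>\<bar>q\<bar>\<^sup>2 < X 0\<close> are not controlled.\<close>

lemma cantor_set_badly_approximable:
  assumes d: "d > 0" and c: "0 < c" "4 * (real N)\<^sup>2 * c \<le> sep_const d"
    and m: "0 < m" "m + 121 \<le> N * M" "real N powr s \<le> m"
  obtains K where "K \<noteq> {}" "K \<subseteq> cell 0 (0, 0)"
    "\<And>s'. 0 < s' \<Longrightarrow> s' \<le> s \<Longrightarrow> hausdorff_measure s' K \<noteq> 0"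
    "\<And>z p q. z \<in> K \<Longrightarrow> p \<in> \<O> d \<Longrightarrow> q \<in> \<O> d \<Longrightarrow> q \<noteq> 0 \<Longrightarrow> sep_const d / (4 * N * \<rho>) \<le> (cmod q)\<^sup>2 \<Longrightarrow>
      c \<le> (cmod q)\<^sup>2 * dist z (p / q)"
proof -
  define \<kappa> where "\<kappa> = sep_const d"
  have \<kappa>: "\<kappa> > 0" using d by (simp add: \<kappa>_def sep_const_pos)
  have N0: "real N > 0" using N by simp
  define X where "X k = real N ^ k * \<kappa> / (4 * N * \<rho>)" for k
  have X0: "0 < X k" for k using N0 \<kappa> \<rho> by (simp add: X_def)
  define bad where "bad k v = {v' \<in> grid_kids N M v. \<exists>p\<in>\<O> d. \<exists>q\<in>\<O> d. q \<noteq> 0 \<and> X k \<le> (cmod q)\<^sup>2 \<and>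
      (cmod q)\<^sup>2 < X (Suc k) \<and> (\<exists>x\<in>cell (Suc k) v'. dist x (p / q) < c / (cmod q)\<^sup>2)}" for k v
  \<comment> \<open>a neighbourhood removed at step k is no larger than a cell of level k + 1\<close>
  have rad: "c / h \<le> \<rho> / real N ^ Suc k" if "X k \<le> h" for k h
  proof -
    have "c / h \<le> c / X k" using that c X0[of k] by (intro divide_left_mono) auto
    also have "c / X k = (4 * (real N)\<^sup>2 * c) / \<kappa> * (\<rho> / real N ^ Suc k)"
      using N0 \<kappa> \<rho> by (simp add: X_def field_simps power2_eq_square)
    also have "\<dots> \<le> 1 * (\<rho> / real N ^ Suc k)"
      using c(2) \<kappa> \<rho> N0 by (intro mult_right_mono) (auto simp: \<kappa>_def)
    finally show ?thesis by simp
  qed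
  have "card (bad k v \<inter> grid_kids N M v) \<le> 121" if v: "v \<in> grid_range N M k" for k v
  proof (rule card_grid_near)
    define \<tau> where "\<tau> = \<rho> / real N ^ Suc k"
    have \<tau>: "0 < \<tau>" "2 * \<tau> \<le> \<rho> / real N ^ k"
    proof -
      show "0 < \<tau>" using \<rho> N0 by (simp add: \<tau>_def)
      have "2 * (\<rho> / real N ^ Suc k) \<le> real N * (\<rho> / real N ^ Suc k)"
        using \<rho> N by (intro mult_right_mono) auto
      also have "\<dots> = \<rho> / real N ^ k" using N0 by simp
      finally show "2 * \<tau> \<le> \<rho> / real N ^ k" by (simp add: \<tau>_def)
    qed
    fix v1 v2 assume "v1 \<in> bad k v \<inter> grid_kids N M v" "v2 \<in> bad k v \<inter> grid_kids N M v"
    then obtain p1 q1 x1 p2 q2 x2 where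
      1: "v1 \<in> grid_kids N M v" "p1 \<in> \<O> d" "q1 \<in> \<O> d" "q1 \<noteq> 0" "X k \<le> (cmod q1)\<^sup>2"
         "(cmod q1)\<^sup>2 < X (Suc k)" "x1 \<in> cell (Suc k) v1" "dist x1 (p1 / q1) < c / (cmod q1)\<^sup>2" and
      2: "v2 \<in> grid_kids N M v" "p2 \<in> \<O> d" "q2 \<in> \<O> d" "q2 \<noteq> 0" "X k \<le> (cmod q2)\<^sup>2"
         "(cmod q2)\<^sup>2 < X (Suc k)" "x2 \<in> cell (Suc k) v2" "dist x2 (p2 / q2) < c / (cmod q2)\<^sup>2"
      unfolding bad_def by blast
    have r1: "dist x1 (p1 / q1) < \<tau>" using 1(8) rad[OF 1(5)] by (simp add: \<tau>_def)
    have r2: "dist x2 (p2 / q2) < \<tau>" using 2(8) rad[OF 2(5)] by (simp add: \<tau>_def)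
    have "x1 \<in> cell k v" "x2 \<in> cell k v" using cell_nested[OF v] 1 2 by blast+
    then have "dist x1 x2 \<le> 2 * (\<rho> / real N ^ k)" using cell_dist[OF v, of x1 x2] by simp
    moreover have "dist (p1 / q1) (p2 / q2) \<le> dist x1 (p1 / q1) + dist x1 x2 + dist x2 (p2 / q2)"
      using dist_triangle[of "p1 / q1" "p2 / q2" x1] dist_triangle[of x1 "p2 / q2" x2] by (simp add: dist_commute)
    moreover have "0 < \<rho> / real N ^ k" using \<rho> N0 by simp
    ultimately have "dist (p1 / q1) (p2 / q2) < 4 * (\<rho> / real N ^ k)" using r1 r2 \<tau> by linarith
    moreover have XS: "4 * (\<rho> / real N ^ k) * X (Suc k) = \<kappa>"
      using N0 \<rho> by (simp add: X_def)
    have "4 * (\<rho> / real N ^ k) * (cmod q)\<^sup>2 < sep_const d" if "(cmod q)\<^sup>2 < X (Suc k)" for q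
    proof -
      have "4 * (\<rho> / real N ^ k) * (cmod q)\<^sup>2 < 4 * (\<rho> / real N ^ k) * X (Suc k)"
        using that \<open>0 < \<rho> / real N ^ k\<close> by (intro mult_strict_left_mono) auto
      then show ?thesis using XS by (simp only: \<kappa>_def)
    qed
    ultimately have eq: "p1 / q1 = p2 / q2"
      using 1 2 by (intro near_fractions_unique[OF d, of p1 q1 p2 q2 "\<rho> / real N ^ k"]) auto
    have "dist x1 x2 \<le> dist x1 (p1 / q1) + dist x2 (p1 / q1)" by (rule dist_triangle2)
    also have "\<dots> \<le> 2 * \<tau>" using r1 r2 unfolding eq by linarith
    finally have "dist x1 x2 \<le> 2 * \<rho> / real (N ^ Suc k)" by (simp add: \<tau>_def)
    then show "grid_near v1 v2"
      using grid_kids_range[OF v] 1 2 by (intro cell_near[of v1 "Suc k" v2 x1 x2]) auto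
  qed
  then obtain K where K: "K \<noteq> {}" "K \<subseteq> cell 0 (0, 0)"
    "\<And>s'. 0 < s' \<Longrightarrow> s' \<le> s \<Longrightarrow> hausdorff_measure s' K \<noteq> 0"
    "\<And>z k. z \<in> K \<Longrightarrow> \<exists>v\<in>grid_range N M k. \<exists>v'\<in>grid_kids N M v - bad k v. z \<in> cell (Suc k) v'"
    using cantor_set_avoiding[of bad, OF _ m] by metis
  have "c \<le> (cmod q)\<^sup>2 * dist z (p / q)"
    if z: "z \<in> K" and pq: "p \<in> \<O> d" "q \<in> \<O> d" "q \<noteq> 0" and q: "sep_const d / (4 * N * \<rho>) \<le> (cmod q)\<^sup>2" for z p q
  proof -
    have "\<exists>k. (cmod q)\<^sup>2 / X 0 < real N ^ k" using N by (intro real_arch_pow) auto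
    then obtain k0 where "(cmod q)\<^sup>2 < real N ^ k0 * X 0" using X0[of 0] by (auto simp: pos_divide_less_eq)
    then have k0: "(cmod q)\<^sup>2 < X k0" by (simp add: X_def)
    define k where "k = (LEAST k. (cmod q)\<^sup>2 < X (Suc k))"
    have ex: "\<exists>k. (cmod q)\<^sup>2 < X (Suc k)"
    proof (cases k0)
      case 0
      then show ?thesis using k0 q by (simp add: X_def \<kappa>_def)
    qed (use k0 in blast)
    have up: "(cmod q)\<^sup>2 < X (Suc k)" unfolding k_def using ex by (rule LeastI_ex)
    have lo: "X k \<le> (cmod q)\<^sup>2"
    proof (cases k)
      case 0
      then show ?thesis using q by (simp add: X_def \<kappa>_def)
    next
      case (Suc j)
      then have "\<not> (cmod q)\<^sup>2 < X (Suc j)" using not_less_Least[of j "\<lambda>k. (cmod q)\<^sup>2 < X (Suc k)"] by (simp add: k_def)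
      then show ?thesis using Suc by simp
    qed
    obtain v v' where v: "v' \<in> grid_kids N M v" "v' \<notin> bad k v" "z \<in> cell (Suc k) v'"
      using K(4)[OF z, of k] by blast
    then have "\<not> dist z (p / q) < c / (cmod q)\<^sup>2" using pq up lo unfolding bad_def by blast
    then show ?thesis using pq by (simp add: field_simps)
  qed
  then show ?thesis using that K(1-3) by blast
qed

end

section \<open>Lower bounds\<close>

text \<open>Losing the proportion \<open>x / 2\<close> of the \<open>N powr D\<close> children of every cell costs at most \<open>x / ln N\<close> in dimension,
  because \<open>exp (- x) \<le> 1 - x / 2\<close> on the unit interval.\<close>

lemma powr_dimension_defect_le:
  fixes N D x :: real
  assumes "N > 1" "0 \<le> x" "x \<le> 1"
  shows "N powr (D - x / ln N) \<le> N powr D * (1 - x / 2)"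
proof -
  have "ln N > 0" using assms by simp
  then have "N powr (D - x / ln N) = N powr D * exp (- x)"
    using assms(1) by (simp add: powr_def algebra_simps flip: exp_add)
  also have "exp (- x) \<le> 1 - x / 2"
  proof -
    have "0 \<le> x * (1 - x)" using assms by (intro mult_nonneg_nonneg) auto
    then have "1 \<le> (1 - x / 2) * (1 + x)" by (simp add: field_simps)
    also have "\<dots> \<le> (1 - x / 2) * exp x" using assms exp_ge_add_one_self[of x] by (intro mult_left_mono) auto
    finally show ?thesis by (simp add: exp_minus field_simps)
  qed
  then have "N powr D * exp (- x) \<le> N powr D * (1 - x / 2)" by (intro mult_left_mono) auto
  finally show ?thesis .
qed

lemma sep_const_le_1: "d > 0 \<Longrightarrow> sep_const d \<le> 1"
proof -
  assume "d > 0"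
  then have "1 \<le> (real d)\<^sup>2" by simp
  then have "1 / (4 * (real d)\<^sup>2) \<le> 1 / 1" by (intro frac_le) auto
  then show ?thesis by (simp add: sep_const_def)
qed

lemma plane_grid_cells:
  assumes "2 \<le> N" shows "grid_cells N N 1 (grid_box N)"
proof
  show "compact (grid_box N k p)" for k p by (simp add: grid_box_def)
  have N: "N > 0" using assms by simp
  show "grid_box N k p \<noteq> {}" for k p
  proof -
    have "Complex (real_of_int (fst p) / real N ^ k) (real_of_int (snd p) / real N ^ k) \<in> grid_box N k p"
      using grid_interval_nonempty[OF N] by (simp add: mem_grid_box)
    then show ?thesis by blast
  qed
  show "grid_box N (Suc k) p' \<subseteq> grid_box N k p" if "p' \<in> grid_kids N N p" for k p p'
    by (rule grid_box_nested[OF N that])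
  show "dist x y \<le> 2 * 1 / real (N ^ k)" if "x \<in> grid_box N k p" "y \<in> grid_box N k p" for x y k p
    using grid_box_dist_le[OF that] by simp
  show "grid_near p p'" if x: "x \<in> grid_box N k p" and y: "y \<in> grid_box N k p'"
      and xy: "dist x y \<le> 2 * 1 / real (N ^ k)" for p p' x y k
  proof -
    have "2 / real N ^ k \<le> 4 / real N ^ k" by (intro divide_right_mono) auto
    then have "\<bar>Re x - Re y\<bar> \<le> 4 / real N ^ k" "\<bar>Im x - Im y\<bar> \<le> 4 / real N ^ k"
      using xy abs_Re_le_cmod[of "x - y"] abs_Im_le_cmod[of "x - y"] by (auto simp: dist_norm)
    then show ?thesis
      using x y unfolding mem_grid_box grid_near_def by (blast intro: grid_interval_close[OF N])
  qed
qed (use assms in auto)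

text \<open>The Cantor set in the unit square: all fractions are covered by the construction, since \<open>X 0 \<le> 1 \<le> \<bar>q\<bar>\<^sup>2\<close>. It
  keeps \<open>N\<^sup>2 - 121\<close> children at each step, and \<open>242 = 2 * 121\<close>.\<close>

lemma sublevel_dim_ge:
  assumes d: "d > 0" and c: "0 < c" "4 * (real N)\<^sup>2 * c \<le> sep_const d" and N242: "242 \<le> N"
  shows "ereal (2 - 242 / ((real N)\<^sup>2 * ln N)) \<le> hausdorff_dim {z. c \<le> approx_const d z}"
proof -
  interpret grid_cells N N 1 "grid_box N" by (rule plane_grid_cells) (use N242 in simp)
  have N2: "242 * 242 \<le> N * N" using N242 by (intro mult_le_mono) auto
  have "real N powr (2 - (242 / (real N)\<^sup>2) / ln N) \<le> real N powr 2 * (1 - (242 / (real N)\<^sup>2) / 2)"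
  proof (rule powr_dimension_defect_le)
    have "242 \<le> (real N)\<^sup>2" using N2 by (simp add: power2_eq_square flip: of_nat_mult)
    moreover from this have "0 < (real N)\<^sup>2" by linarith
    ultimately show "242 / (real N)\<^sup>2 \<le> 1" by (simp only: divide_le_eq_1_pos)
  qed (use N242 in auto)
  also have "real N powr 2 = (real N)\<^sup>2" using N242 by (simp add: powr_numeral)
  also have "(real N)\<^sup>2 * (1 - (242 / (real N)\<^sup>2) / 2) = real (N * N - 121)"
    using N242 N2 by (simp add: of_nat_diff field_simps power2_eq_square)
  finally have m: "real N powr (2 - 242 / ((real N)\<^sup>2 * ln N)) \<le> real (N * N - 121)" by simp
  have m0: "0 < N * N - 121" "N * N - 121 + 121 \<le> N * N" using N2 by simp_all
  obtain K where K: "\<And>s'. 0 < s' \<Longrightarrow> s' \<le> 2 - 242 / ((real N)\<^sup>2 * ln N) \<Longrightarrow> hausdorff_measure s' K \<noteq> 0"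
    "\<And>z p q. z \<in> K \<Longrightarrow> p \<in> \<O> d \<Longrightarrow> q \<in> \<O> d \<Longrightarrow> q \<noteq> 0 \<Longrightarrow> sep_const d / (real (4 * N) * 1) \<le> (cmod q)\<^sup>2 \<Longrightarrow>
      c \<le> (cmod q)\<^sup>2 * dist z (p / q)"
    by (rule cantor_set_badly_approximable[OF d c m0 m]) (rule that)
  have "sep_const d / (real (4 * N) * 1) \<le> (cmod q)\<^sup>2" if "q \<in> \<O> d" "q \<noteq> 0" for q
  proof -
    have "sep_const d / (real (4 * N) * 1) \<le> 1 / 1"
      using sep_const_le_1[OF d] N242 by (intro frac_le) auto
    also have "1 / 1 \<le> (cmod q)\<^sup>2" using ring_of_integers_norm_ge_1[OF that] by simp
    finally show ?thesis .
  qed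
  then have "K \<subseteq> {z. c \<le> approx_const d z}"
    unfolding approx_const_ge_iff using K(2) by blast
  then show ?thesis using K(1) by (rule hausdorff_dim_ge)
qed

text \<open>An arc of the circle \<open>\<bar>z\<bar> = c\<close>; the root cell consists of the angles in the unit interval, so that chords and
  arcs have comparable lengths.\<close>

definition arc_cell :: "real \<Rightarrow> nat \<Rightarrow> nat \<Rightarrow> int \<times> int \<Rightarrow> complex set" where
  "arc_cell c N k p = (\<lambda>u. of_real c * cis u) ` {real_of_int (fst p) / real N ^ k..(real_of_int (fst p) + 1) / real N ^ k}"

lemma arc_grid_cells:
  assumes "2 \<le> N" "0 < c" shows "grid_cells N 1 c (arc_cell c N)"
proof
  have N: "N > 0" using assms by simp
  have scale: "dist (of_real c * cis u) (of_real c * cis v) = c * dist (cis u) (cis v)" for u v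
    using assms(2) by (simp add: dist_norm norm_mult flip: right_diff_distrib)
  have unit: "u \<in> {0..1}" if p: "p \<in> grid_range N 1 k"
      and u: "u \<in> {real_of_int (fst p) / real N ^ k..(real_of_int (fst p) + 1) / real N ^ k}" for p k u
  proof -
    have "0 \<le> fst p" "fst p + 1 \<le> int N ^ k" using p by (auto simp: grid_range_def)
    then have "0 \<le> real_of_int (fst p)" "real_of_int (fst p + 1) \<le> real_of_int (int N ^ k)"
      by (simp_all only: of_int_le_iff of_int_0_le_iff)
    then have "0 \<le> real_of_int (fst p) / real N ^ k" "(real_of_int (fst p) + 1) / real N ^ k \<le> 1"
      using N by (simp_all add: divide_le_eq_1)
    then show ?thesis using u by auto
  qed
  show "compact (arc_cell c N k p)" for k p
    unfolding arc_cell_def by (intro compact_continuous_image continuous_intros compact_Icc)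
  show "arc_cell c N k p \<noteq> {}" for k p
    using grid_interval_nonempty[OF N] by (simp add: arc_cell_def)
  show "arc_cell c N (Suc k) p' \<subseteq> arc_cell c N k p" if "p' \<in> grid_kids N 1 p" for k p p'
  proof -
    have "int N * fst p \<le> fst p'" "fst p' < int N * fst p + int N" using that by (auto simp: grid_kids_def)
    from grid_interval_nested[OF N this, of k] show ?thesis
      unfolding arc_cell_def by (intro image_mono) auto
  qed
  show "dist x y \<le> 2 * c / real (N ^ k)"
    if p: "p \<in> grid_range N 1 k" and xy: "x \<in> arc_cell c N k p" "y \<in> arc_cell c N k p" for x y k p
  proof -
    obtain u v where u: "x = of_real c * cis u" "u \<in> {real_of_int (fst p) / real N ^ k..(real_of_int (fst p) + 1) / real N ^ k}"
      and v: "y = of_real c * cis v" "v \<in> {real_of_int (fst p) / real N ^ k..(real_of_int (fst p) + 1) / real N ^ k}"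
      using xy unfolding arc_cell_def by blast
    have "\<bar>u - v\<bar> \<le> 1" using unit[OF p u(2)] unit[OF p v(2)] by auto
    then have "dist x y \<le> c * \<bar>u - v\<bar>"
      unfolding u v scale using assms(2) by (intro mult_left_mono dist_cis_bounds) auto
    also have "\<bar>u - v\<bar> \<le> 2 / real N ^ k"
    proof -
      have "\<bar>u - v\<bar> \<le> 1 / real N ^ k" using u(2) v(2) by (auto simp: add_divide_distrib)
      also have "\<dots> \<le> 2 / real N ^ k" by (intro divide_right_mono) auto
      finally show ?thesis .
    qed
    then have "c * \<bar>u - v\<bar> \<le> c * (2 / real N ^ k)" using assms(2) by (intro mult_left_mono) auto
    finally show ?thesis by (simp add: mult.commute)
  qed
  show "grid_near p p'"
    if p: "p \<in> grid_range N 1 k" "p' \<in> grid_range N 1 k" and mem: "x \<in> arc_cell c N k p" "y \<in> arc_cell c N k p'"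
      and xy: "dist x y \<le> 2 * c / real (N ^ k)" for p p' x y k
  proof -
    obtain u v where u: "x = of_real c * cis u" "u \<in> {real_of_int (fst p) / real N ^ k..(real_of_int (fst p) + 1) / real N ^ k}"
      and v: "y = of_real c * cis v" "v \<in> {real_of_int (fst p') / real N ^ k..(real_of_int (fst p') + 1) / real N ^ k}"
      using mem unfolding arc_cell_def by blast
    have "\<bar>u - v\<bar> \<le> 1" using unit[OF p(1) u(2)] unit[OF p(2) v(2)] by auto
    then have "c * (\<bar>u - v\<bar> / 2) \<le> dist x y"
      unfolding u v scale using assms(2) by (intro mult_left_mono dist_cis_bounds) auto
    also have "\<dots> \<le> c * (2 / real N ^ k)" using xy by (simp add: mult.commute)
    finally have "\<bar>u - v\<bar> / 2 \<le> 2 / real N ^ k" using assms(2) by (rule mult_left_le_imp_le)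
    then have "\<bar>u - v\<bar> \<le> 4 / real N ^ k" by simp
    then have "\<bar>fst p - fst p'\<bar> \<le> 5" using u(2) v(2) by (intro grid_interval_close[OF N, of _ k u _ v]) auto
    moreover have "snd p = 0" "snd p' = 0" using p by (auto simp: grid_range_def)
    ultimately show ?thesis by (simp add: grid_near_def)
  qed
qed (use assms in auto)

text \<open>A nonzero fraction has modulus at least \<open>1 / \<bar>q\<bar>\<close>, hence distance at least \<open>1 / \<bar>q\<bar> - c\<close> from the small
  circle \<open>\<bar>z\<bar> = c\<close>. The fractions equal to \<open>0\<close> contribute \<open>\<bar>q\<bar>\<^sup>2 c\<close>.\<close>

lemma small_denominators_far_from_origin:
  assumes O: "p \<in> \<O> d" "q \<in> \<O> d" "q \<noteq> 0" and c: "0 < c" "c \<le> 1 / 2" and z: "cmod z = c"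
    and q: "(cmod q)\<^sup>2 \<le> 1 / (4 * c\<^sup>2)"
  shows "c \<le> (cmod q)\<^sup>2 * dist z (p / q)"
proof -
  have q1: "1 \<le> cmod q" by (rule ring_of_integers_norm_ge_1[OF O(2,3)])
  show ?thesis
  proof (cases "p = 0")
    case True
    have "1 * c \<le> (cmod q)\<^sup>2 * c" using q1 c by (intro mult_right_mono) auto
    then show ?thesis using True z by (simp add: dist_norm)
  next
    case False
    then have p1: "1 \<le> cmod p" by (rule ring_of_integers_norm_ge_1[OF O(1)])
    have "(cmod q)\<^sup>2 \<le> (1 / (2 * c))\<^sup>2" using q by (simp add: power_divide power_mult_distrib)
    then have "cmod q \<le> 1 / (2 * c)" using c by (rule_tac power2_le_imp_le) auto
    then have cq: "c * cmod q \<le> 1 / 2" using c by (simp add: field_simps)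
    have "1 / cmod q \<le> cmod (p / q)" using p1 by (simp add: norm_divide divide_right_mono)
    then have "1 / cmod q - c \<le> dist z (p / q)"
      using norm_triangle_ineq2[of "p / q" z] z by (simp add: dist_norm norm_minus_commute)
    then have "(cmod q)\<^sup>2 * (1 / cmod q - c) \<le> (cmod q)\<^sup>2 * dist z (p / q)" by (intro mult_left_mono) auto
    moreover have "(cmod q)\<^sup>2 * (1 / cmod q - c) = cmod q * (1 - c * cmod q)"
      using q1 by (simp add: power2_eq_square field_simps)
    moreover have "1 * (1 / 2) \<le> cmod q * (1 - c * cmod q)" using q1 cq by (intro mult_mono) auto
    ultimately show ?thesis using c by linarith
  qed
qed

text \<open>The Cantor set lies on the circle \<open>\<bar>z\<bar> = c\<close>, where the fraction \<open>0 / 1\<close> bounds the approximation constant by \<open>c\<close>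
  from above. The construction gives the matching lower bound for the fractions with
  \<open>\<bar>q\<bar>\<^sup>2 \<ge> \<kappa> / (4 N c)\<close>, and the remaining ones satisfy \<open>\<bar>q\<bar>\<^sup>2 \<le> 1 / (4 c\<^sup>2)\<close>.\<close>

lemma level_dim_ge:
  assumes d: "d > 0" and c: "0 < c" "4 * (real N)\<^sup>2 * c \<le> sep_const d" and N242: "242 \<le> N"
  shows "ereal (1 - 242 / (N * ln N)) \<le> hausdorff_dim {z. approx_const d z = c}"
    and "\<exists>z. approx_const d z = c"
proof -
  interpret grid_cells N 1 c "arc_cell c N" by (rule arc_grid_cells) (use N242 c in auto)
  have "4 * 1 * c \<le> 4 * (real N)\<^sup>2 * c" using N242 c by (intro mult_right_mono) auto
  then have c2: "c \<le> 1 / 2" using c(2) sep_const_le_1[OF d] by simp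
  have "real N powr (1 - (242 / real N) / ln N) \<le> real N powr 1 * (1 - (242 / real N) / 2)"
    by (rule powr_dimension_defect_le) (use N242 in auto)
  also have "\<dots> = real (N * 1 - 121)" using N242 by (simp add: of_nat_diff field_simps)
  finally have m: "real N powr (1 - 242 / (N * ln N)) \<le> real (N * 1 - 121)" by simp
  have m0: "0 < N * 1 - 121" "N * 1 - 121 + 121 \<le> N * 1" using N242 by simp_all
  obtain K where K: "K \<noteq> {}" "K \<subseteq> arc_cell c N 0 (0, 0)"
    "\<And>s'. 0 < s' \<Longrightarrow> s' \<le> 1 - 242 / (N * ln N) \<Longrightarrow> hausdorff_measure s' K \<noteq> 0"
    "\<And>z p q. z \<in> K \<Longrightarrow> p \<in> \<O> d \<Longrightarrow> q \<in> \<O> d \<Longrightarrow> q \<noteq> 0 \<Longrightarrow> sep_const d / (4 * N * c) \<le> (cmod q)\<^sup>2 \<Longrightarrow>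
      c \<le> (cmod q)\<^sup>2 * dist z (p / q)"
    by (rule cantor_set_badly_approximable[OF d c m0 m]) (rule that)
  have "approx_const d z = c" if z: "z \<in> K" for z
  proof (rule antisym)
    have zc: "cmod z = c" using z K(2) c by (auto simp: arc_cell_def norm_mult)
    have "\<forall>p\<in>\<O> d. \<forall>q\<in>\<O> d. q \<noteq> 0 \<longrightarrow> approx_const d z \<le> (cmod q)\<^sup>2 * dist z (p / q)"
      using approx_const_ge_iff[of "approx_const d z" d z] by simp
    then have "approx_const d z \<le> (cmod 1)\<^sup>2 * dist z (0 / 1)"
      using zero_one_in_ring_of_integers[of d] one_neq_zero by blast
    then show "approx_const d z \<le> c" by (simp add: zc)
    have "sep_const d / (4 * N * c) \<le> 1 / (4 * c\<^sup>2)"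
    proof -
      have "sep_const d / (4 * N * c) \<le> 1 / (4 * 1 * c)"
        using sep_const_le_1[OF d] N242 c by (intro frac_le mult_right_mono mult_left_mono) auto
      also have "\<dots> \<le> 1 / (4 * (c * c))"
      proof -
        have "c * c \<le> 1 * c" using c c2 by (intro mult_right_mono) auto
        then show ?thesis using c by (intro divide_left_mono) auto
      qed
      finally show ?thesis by (simp add: power2_eq_square)
    qed
    then have "c \<le> (cmod q)\<^sup>2 * dist z (p / q)" if "p \<in> \<O> d" "q \<in> \<O> d" "q \<noteq> 0" for p q
      using K(4)[OF z that] small_denominators_far_from_origin[OF that c(1) c2 zc] by linarith
    then show "c \<le> approx_const d z" by (simp add: approx_const_ge_iff)
  qed
  then have sub: "K \<subseteq> {z. approx_const d z = c}" by blast
  then show "\<exists>z. approx_const d z = c" using K(1) by blast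
  show "ereal (1 - 242 / (N * ln N)) \<le> hausdorff_dim {z. approx_const d z = c}"
    using sub K(3) by (rule hausdorff_dim_ge)
qed

section \<open>Upper bounds\<close>

text \<open>After \<open>k\<close> subdivisions at most \<open>(N\<^sup>2 - 1) ^ k\<close> boxes of diameter at most \<open>2 / N ^ k\<close> are left to cover the set in
  a unit box, and their total weight tends to \<open>0\<close>.\<close>

lemma grid_porous_null_in_box:
  assumes N: "2 \<le> N" and hole: "\<And>k p. \<exists>p'\<in>grid_kids N N p. grid_box N (Suc k) p' \<inter> A = {}"
    and s: "real N ^ 2 - 1 < real N powr s" "0 < s"
  shows "hausdorff_measure s (A \<inter> grid_box N 0 r) = 0"
proof -
  obtain h where h: "\<And>k p. h k p \<in> grid_kids N N p" "\<And>k p. grid_box N (Suc k) (h k p) \<inter> A = {}"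
  proof -
    have "\<forall>k p. \<exists>p'. p' \<in> grid_kids N N p \<and> grid_box N (Suc k) p' \<inter> A = {}" using hole by blast
    then show ?thesis using that by metis
  qed
  define chl where "chl k p = grid_kids N N p - {h k p}" for k p
  let ?C = "cantor_level chl r"
  have N0: "real N > 0" using N by simp
  define b where "b = N * N - 1"
  have card_chl: "finite (chl k p)" "card (chl k p) = b" for k p
    using h(1)[of k p] by (simp_all add: chl_def b_def)
  have C: "finite (?C k) \<and> card (?C k) \<le> b ^ k" for k
  proof (induction k)
    case (Suc k)
    have "card (?C (Suc k)) \<le> (\<Sum>p\<in>?C k. card (chl k p))"
      unfolding cantor_level.simps by (rule card_UN_le) (use Suc in blast)
    also have "\<dots> = card (?C k) * b" by (simp add: card_chl)
    also have "\<dots> \<le> b ^ k * b" using Suc by (intro mult_right_mono) auto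
    finally show ?case using Suc card_chl by (simp add: mult.commute)
  qed simp
  have cover: "A \<inter> grid_box N 0 r \<subseteq> (\<Union>p\<in>?C k. grid_box N k p)" for k
  proof (induction k)
    case (Suc k)
    show ?case
    proof
      fix z assume z: "z \<in> A \<inter> grid_box N 0 r"
      then obtain p where p: "p \<in> ?C k" "z \<in> grid_box N k p" using Suc by blast
      obtain p' where p': "p' \<in> grid_kids N N p" "z \<in> grid_box N (Suc k) p'"
        using grid_box_cover[OF _ p(2)] N by auto
      have "p' \<noteq> h k p" using p'(2) h(2)[of k p] z by blast
      then have "p' \<in> ?C (Suc k)" using p p' by (auto simp: chl_def)
      then show "z \<in> (\<Union>p\<in>?C (Suc k). grid_box N (Suc k) p)" using p' by blast
    qed
  qed simp
  have diam: "diameter (grid_box N k p) \<le> 2 / real N ^ k" for k p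
    by (rule diameter_le) (use grid_box_dist_le[of _ N k p] in \<open>auto simp: dist_norm\<close>)
  have diam0: "0 \<le> diameter (grid_box N k p)" for k p by (rule diameter_ge_0[OF bounded_grid_box])
  have Ns: "0 < real N powr s" using N0 by simp
  have "1 \<le> N * N" using N by simp
  then have bN: "real b = real N ^ 2 - 1" by (simp add: b_def of_nat_diff power2_eq_square)
  then have ratio: "0 \<le> real b / real N powr s" "real b / real N powr s < 1"
    using s Ns by simp_all
  show ?thesis
  proof (rule hausdorff_null_of_finite_covers)
    fix \<delta> e :: real assume \<delta>: "\<delta> > 0" and e: "e > 0"
    have "(\<lambda>k. 2 powr s * (real b / real N powr s) ^ k) \<longlonglongrightarrow> 2 powr s * 0"
      by (rule tendsto_mult[OF tendsto_const LIMSEQ_realpow_zero[OF ratio]])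
    moreover have "2 powr s * 0 < e" using e by simp
    ultimately have 1: "eventually (\<lambda>k. 2 powr s * (real b / real N powr s) ^ k < e) sequentially"
      by (rule order_tendstoD)
    have "(\<lambda>k. 2 * (1 / real N) ^ k) \<longlonglongrightarrow> 2 * 0"
      using N by (intro tendsto_mult[OF tendsto_const LIMSEQ_realpow_zero]) auto
    moreover have "2 * 0 < \<delta>" using \<delta> by simp
    ultimately have 2: "eventually (\<lambda>k. 2 * (1 / real N) ^ k < \<delta>) sequentially"
      by (rule order_tendstoD)
    obtain k where k: "2 powr s * (real b / real N powr s) ^ k < e" "2 * (1 / real N) ^ k < \<delta>"
      using eventually_conj[OF 1 2] by (auto simp: eventually_sequentially)
    have "diameter (grid_box N k p) \<le> \<delta>" for p
      using diam[of k p] k(2) by (simp add: power_one_over)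
    moreover have "(\<Sum>p\<in>?C k. diameter (grid_box N k p) powr s) \<le> e"
    proof -
      have "(\<Sum>p\<in>?C k. diameter (grid_box N k p) powr s) \<le> (\<Sum>p\<in>?C k. (2 / real N ^ k) powr s)"
        using s by (intro sum_mono powr_mono2 diam diam0) auto
      also have "\<dots> = real (card (?C k)) * (2 / real N ^ k) powr s" by simp
      also have "\<dots> \<le> real (b ^ k) * (2 / real N ^ k) powr s"
        using C[of k] by (intro mult_right_mono of_nat_mono) auto
      also have "(2 / real N ^ k) powr s = 2 powr s / (real N ^ k) powr s" using N0 by (simp add: powr_divide)
      also have "(real N ^ k) powr s = (real N powr real k) powr s" using N0 by (simp add: powr_realpow)
      also have "\<dots> = (real N powr s) ^ k" using N0 by (simp add: powr_powr powr_power mult.commute)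
      also have "real (b ^ k) * (2 powr s / (real N powr s) ^ k) = 2 powr s * (real b / real N powr s) ^ k"
        by (simp add: power_divide)
      finally show ?thesis using k(1) by simp
    qed
    ultimately show "\<exists>I (V :: int \<times> int \<Rightarrow> complex set). finite I \<and> A \<inter> grid_box N 0 r \<subseteq> (\<Union>i\<in>I. V i) \<and>
        (\<forall>i\<in>I. bounded (V i) \<and> diameter (V i) \<le> \<delta>) \<and> (\<Sum>i\<in>I. diameter (V i) powr s) \<le> e"
      using C[of k] cover[of k] bounded_grid_box[of N k]
      by (intro exI[of _ "?C k"] exI[of _ "grid_box N k"]) auto
  qed
qed

lemma grid_porous_dim_le:
  assumes N: "3 \<le> N" and hole: "\<And>k p. \<exists>p'\<in>grid_kids N N p. grid_box N (Suc k) p' \<inter> A = {}"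
  shows "hausdorff_dim A \<le> ereal (2 - 1 / ((real N)\<^sup>2 * ln N))"
proof (rule hausdorff_dim_le)
  have N0: "real N > 0" using N by simp
  have "exp 1 \<le> real N" using N exp_le by linarith
  then have lnN: "1 \<le> ln N" using N0 by (simp add: ln_ge_iff)
  have "1 * 1 \<le> (real N)\<^sup>2 * ln N" using N lnN by (intro mult_mono) auto
  then have "1 / ((real N)\<^sup>2 * ln N) \<le> 1" by (simp add: divide_le_eq_1)
  then show nonneg: "0 \<le> 2 - 1 / ((real N)\<^sup>2 * ln N)" by simp
  fix s' assume s': "2 - 1 / ((real N)\<^sup>2 * ln N) < s'"
  have "real N powr 2 = (real N)\<^sup>2" using N0 by (simp add: powr_numeral)
  have "(real N)\<^sup>2 - 1 = (real N)\<^sup>2 * (1 + (- 1 / (real N)\<^sup>2))" using N0 by (simp add: field_simps)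
  also have "\<dots> \<le> (real N)\<^sup>2 * exp (- 1 / (real N)\<^sup>2)"
    by (intro mult_left_mono exp_ge_add_one_self) simp
  also have "exp (- 1 / (real N)\<^sup>2) = real N powr (- 1 / ((real N)\<^sup>2 * ln N))"
    using N0 N by (simp add: powr_def)
  also have "(real N)\<^sup>2 * real N powr (- 1 / ((real N)\<^sup>2 * ln N)) = real N powr (2 + - 1 / ((real N)\<^sup>2 * ln N))"
    unfolding powr_add using \<open>real N powr 2 = (real N)\<^sup>2\<close> by simp
  also have "\<dots> < real N powr s'" using s' N by (intro powr_less_mono) auto
  finally have grow: "real N ^ 2 - 1 < real N powr s'" .
  have "s' > 0" using s' nonneg by linarith
  have "hausdorff_measure s' (\<Union>n. A \<inter> grid_box N 0 (from_nat n)) = 0"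
    by (intro hausdorff_null_UN grid_porous_null_in_box hole grow \<open>s' > 0\<close>) (use N in simp)
  moreover have "A \<subseteq> (\<Union>n. A \<inter> grid_box N 0 (from_nat n))"
  proof
    fix z assume "z \<in> A"
    let ?n = "to_nat (\<lfloor>Re z\<rfloor>, \<lfloor>Im z\<rfloor>)"
    have "z \<in> grid_box N 0 (from_nat ?n)"
      unfolding from_nat_to_nat mem_grid_box by (simp; linarith)
    then show "z \<in> (\<Union>n. A \<inter> grid_box N 0 (from_nat n))" using \<open>z \<in> A\<close> by blast
  qed
  ultimately show "hausdorff_measure s' A = 0" by (rule hausdorff_null_subset)
qed

text \<open>Dirichlet gives \<open>\<bar>q\<bar> \<le> C n\<close> and \<open>\<bar>q z - p\<bar> \<le> C / n\<close>. The lower bound \<open>c \<le> \<bar>q\<bar> \<bar>q z - p\<bar>\<close> then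
  forces \<open>\<bar>q\<bar> \<ge> c n / C\<close>, so \<open>\<bar>z - p / q\<bar> \<le> C\<^sup>2 / (c n\<^sup>2)\<close>. This is at most \<open>l / 8\<close> once
  \<open>n\<^sup>2 \<ge> x = 8 C\<^sup>2 / (c l)\<close>, and choosing \<open>n\<close> as small as possible keeps \<open>\<bar>q\<bar>\<^sup>2 \<le> C\<^sup>2 n\<^sup>2\<close> of order \<open>1 / (c l)\<close>.\<close>

lemma fraction_near_badly_approximable:
  assumes d: "d > 0" and c: "0 < c" "c \<le> 1" and l: "0 < l" "l \<le> 1" and z: "c \<le> approx_const d z"
  shows "\<exists>p\<in>\<O> d. \<exists>q\<in>\<O> d. q \<noteq> 0 \<and> dist z (p / q) \<le> l / 8 \<and> (cmod q)\<^sup>2 \<le> 32 * (1 + sqrt d) ^ 4 / (c * l)"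
proof -
  define C where "C = 1 + sqrt d"
  have C: "1 \<le> C" by (simp add: C_def)
  have cl: "0 < c * l" "c * l \<le> 1" using c l by (auto intro!: mult_le_one)
  define x where "x = 8 * C\<^sup>2 / (c * l)"
  have "1 \<le> 8 * C\<^sup>2" using one_le_power[OF C, of 2] by linarith
  then have "c * l \<le> 8 * C\<^sup>2" using cl by linarith
  then have x1: "1 \<le> x" using cl by (simp add: x_def le_divide_eq)
  then have sx: "1 \<le> sqrt x" by simp
  define n where "n = nat \<lceil>sqrt x\<rceil>"
  have n: "sqrt x \<le> n" "n \<le> 2 * sqrt x" "0 < n" using sx unfolding n_def by linarith+
  have n0: "real n > 0" using n by simp
  have sq: "(sqrt x)\<^sup>2 = x" "(2 * sqrt x)\<^sup>2 = 4 * x" using x1 by (simp_all add: power_mult_distrib)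
  have "(sqrt x)\<^sup>2 \<le> (real n)\<^sup>2" by (rule power_mono[OF n(1)]) (use sx in simp)
  moreover have "(real n)\<^sup>2 \<le> (2 * sqrt x)\<^sup>2" by (rule power_mono[OF n(2)]) simp
  ultimately have n2: "x \<le> (real n)\<^sup>2" "(real n)\<^sup>2 \<le> 4 * x" unfolding sq by blast+
  obtain p q where pq: "p \<in> \<O> d" "q \<in> \<O> d" "q \<noteq> 0" "cmod q \<le> C * n" "cmod (q * z - p) \<le> C / n"
    using dirichlet_approximation[OF d n(3), of z] unfolding C_def by blast
  have q0: "cmod q > 0" using pq by simp
  have eq: "dist z (p / q) = cmod (q * z - p) / cmod q"
    using pq(3) by (simp add: dist_norm field_simps flip: norm_divide)
  have "c \<le> (cmod q)\<^sup>2 * dist z (p / q)" using z pq unfolding approx_const_ge_iff by blast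
  also have "\<dots> = cmod q * cmod (q * z - p)" unfolding eq using q0 by (simp add: power2_eq_square)
  also have "\<dots> \<le> cmod q * (C / n)" by (intro mult_left_mono pq) simp
  finally have qn: "c * n / C \<le> cmod q" using n0 C by (simp add: field_simps)
  have cnC: "0 < c * n / C" using c n0 C by simp
  have "dist z (p / q) \<le> (C / n) / (c * n / C)"
    unfolding eq by (rule frac_le) (use pq(5) qn cnC C n0 in auto)
  also have "\<dots> = C\<^sup>2 / (c * (real n)\<^sup>2)" using C c n0 by (simp add: power2_eq_square field_simps)
  also have "\<dots> \<le> C\<^sup>2 / (c * x)" using n2 x1 c n0
    by (intro divide_left_mono mult_left_mono mult_pos_pos zero_less_power) auto
  also have "\<dots> = l / 8" using C c l by (simp add: x_def)
  finally have 1: "dist z (p / q) \<le> l / 8" .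
  have "(cmod q)\<^sup>2 \<le> (C * n)\<^sup>2" using pq(4) by (intro power_mono) auto
  also have "\<dots> \<le> C\<^sup>2 * (4 * x)" unfolding power_mult_distrib using n2 by (intro mult_left_mono) auto
  also have "\<dots> = 32 * C ^ 4 / (c * l)" by (simp add: x_def power2_eq_square power4_eq_xxxx)
  finally show ?thesis using 1 pq unfolding C_def by blast
qed

text \<open>If no point of the set is close to the centre \<open>w\<close> of the box, the child containing \<open>w\<close> is disjoint from the set.
  Otherwise a point near \<open>w\<close> has a fraction \<open>P / q\<close> near it, still inside the box, with
  \<open>\<bar>q\<bar>\<^sup>2 = O (1 / (c l))\<close>. The child containing \<open>P / q\<close> has diameter at most \<open>2 l / N < c / \<bar>q\<bar>\<^sup>2\<close>, so it
  contains no point of the set.\<close>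

lemma sublevel_grid_hole:
  assumes d: "d > 0" and c: "0 < c" "c \<le> 1" and N: "8 \<le> N" "64 * (1 + sqrt d) ^ 4 / c\<^sup>2 < N"
  shows "\<exists>p'\<in>grid_kids N N p. grid_box N (Suc k) p' \<inter> {z. c \<le> approx_const d z} = {}"
proof -
  define A where "A = {z. c \<le> approx_const d z}"
  define l where "l = 1 / real N ^ k"
  have N0: "N > 0" "real N > 0" using N by auto
  have l: "0 < l" "l \<le> 1" using N by (auto simp: l_def divide_le_eq_1)
  have kid: "dist x y \<le> 2 * l / N" if "x \<in> grid_box N (Suc k) p'" "y \<in> grid_box N (Suc k) p'" for x y p'
    using grid_box_dist_le[OF that] by (simp add: l_def mult.commute)
  define w where "w = Complex ((real_of_int (fst p) + 1 / 2) / real N ^ k) ((real_of_int (snd p) + 1 / 2) / real N ^ k)"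
  have box: "y \<in> grid_box N k p" if "dist y w \<le> l / 2" for y
  proof -
    have "\<bar>Re y - Re w\<bar> \<le> l / 2" "\<bar>Im y - Im w\<bar> \<le> l / 2"
      using that abs_Re_le_cmod[of "y - w"] abs_Im_le_cmod[of "y - w"] by (auto simp: dist_norm)
    then show ?thesis unfolding mem_grid_box w_def l_def by (simp add: add_divide_distrib abs_le_iff; linarith)
  qed
  have "\<exists>p'\<in>grid_kids N N p. grid_box N (Suc k) p' \<inter> A = {}"
  proof (cases "\<exists>z\<in>A. dist z w \<le> l / 4")
    case False
    obtain p' where p': "p' \<in> grid_kids N N p" "w \<in> grid_box N (Suc k) p'"
      using grid_box_cover[OF N0(1) box[of w]] l by auto
    have "x \<notin> A" if x: "x \<in> grid_box N (Suc k) p'" for x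
    proof -
      have "dist x w \<le> 2 * l / N" by (rule kid[OF x p'(2)])
      also have "\<dots> \<le> 2 * l / 8" using N l by (intro divide_left_mono) auto
      finally show ?thesis using False by auto
    qed
    then show ?thesis using p' by blast
  next
    case True
    then obtain z where z: "c \<le> approx_const d z" "dist z w \<le> l / 4" by (auto simp: A_def)
    obtain P q where q: "P \<in> \<O> d" "q \<in> \<O> d" "q \<noteq> 0" "dist z (P / q) \<le> l / 8"
        "(cmod q)\<^sup>2 \<le> 32 * (1 + sqrt d) ^ 4 / (c * l)"
      using fraction_near_badly_approximable[OF d c l z(1)] by blast
    have "dist (P / q) w \<le> dist z (P / q) + dist z w" by (rule dist_triangle3)
    then have "dist (P / q) w \<le> l / 2" using q(4) z(2) l by linarith
    then obtain p' where p': "p' \<in> grid_kids N N p" "P / q \<in> grid_box N (Suc k) p'"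
      using grid_box_cover[OF N0(1) box] by blast
    have "x \<notin> A" if x: "x \<in> grid_box N (Suc k) p'" for x
    proof
      assume "x \<in> A"
      then have "c \<le> (cmod q)\<^sup>2 * dist x (P / q)" using q unfolding A_def approx_const_ge_iff by blast
      also have "\<dots> \<le> (32 * (1 + sqrt d) ^ 4 / (c * l)) * (2 * l / N)"
        by (intro mult_mono q kid[OF x p'(2)]) (use c l in auto)
      also have "\<dots> = 64 * (1 + sqrt d) ^ 4 / (c * N)" using l by simp
      finally have "N \<le> 64 * (1 + sqrt d) ^ 4 / c\<^sup>2" using c N0 by (simp add: field_simps power2_eq_square)
      then show False using N(2) by simp
    qed
    then show ?thesis using p' by blast
  qed
  then show ?thesis unfolding A_def .
qed

lemma sublevel_dim_le:
  assumes "d > 0" "0 < c" "c \<le> 1" "8 \<le> N" "64 * (1 + sqrt d) ^ 4 / c\<^sup>2 < N"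
  shows "hausdorff_dim {z. c \<le> approx_const d z} \<le> ereal (2 - 1 / ((real N)\<^sup>2 * ln N))"
  by (rule grid_porous_dim_le) (use assms sublevel_grid_hole in auto)

section \<open>Asymptotics of the dimension functions\<close>

lemma sublevel_dim_asymptotic_upper:
  assumes d: "d > 0"
  shows "\<exists>ku>0. \<exists>t0\<ge>1. \<forall>t\<ge>t0. hausdorff_dim {z. exp (- t) \<le> approx_const d z} \<le> ereal (2 - ku / (t * exp (4 * t)))"
proof -
  define B where "B = (1 + sqrt d) ^ 4"
  define E where "E = 66 * B"
  have B: "1 \<le> B" by (simp add: B_def one_le_power)
  have E: "66 \<le> E" using B by (simp add: E_def)
  have "hausdorff_dim {z. exp (- t) \<le> approx_const d z} \<le> ereal (2 - (1 / (3 * E\<^sup>2)) / (t * exp (4 * t)))"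
    if t: "max 1 (ln E) \<le> t" for t
  proof -
    have t1: "1 \<le> t" "ln E \<le> t" using t by auto
    have e1: "1 \<le> exp (2 * t)" using t1 by simp
    \<comment> \<open>the least resolution, up to a constant, at which holes of relative size \<open>exp (- 2 t)\<close> are visible\<close>
    define N where "N = nat \<lceil>65 * B * exp (2 * t)\<rceil>"
    have Be: "1 \<le> B * exp (2 * t)" using mult_mono[of 1 B 1 "exp (2 * t)"] B e1 by simp
    have N: "65 * (B * exp (2 * t)) \<le> N" "N \<le> 65 * (B * exp (2 * t)) + 1"
      using Be unfolding N_def by linarith+
    have NE: "real N \<le> E * exp (2 * t)" using N Be by (simp add: E_def)
    have N65: "65 \<le> real N" using N Be by linarith
    have "64 * (1 + sqrt d) ^ 4 / (exp (- t))\<^sup>2 = 64 * (B * exp (2 * t))"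
      by (simp add: B_def exp_minus power2_eq_square field_simps flip: exp_add)
    also have "\<dots> < N" using N Be by linarith
    finally have hole: "64 * (1 + sqrt d) ^ 4 / (exp (- t))\<^sup>2 < N" .
    have dim: "hausdorff_dim {z. exp (- t) \<le> approx_const d z} \<le> ereal (2 - 1 / ((real N)\<^sup>2 * ln N))"
      by (rule sublevel_dim_le[OF d _ _ _ hole]) (use t1 N65 in auto)
    have "ln N \<le> ln (E * exp (2 * t))" using NE N65 E by simp
    also have "\<dots> = ln E + 2 * t" using E by (simp add: ln_mult)
    also have "\<dots> \<le> 3 * t" using t1 by simp
    finally have lnN: "ln N \<le> 3 * t" .
    have ln0: "0 < ln (real N)" using N65 by simp
    have "(real N)\<^sup>2 * ln N \<le> (E * exp (2 * t))\<^sup>2 * (3 * t)"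
      using NE lnN ln0 E by (intro mult_mono power_mono) auto
    also have "\<dots> = 3 * E\<^sup>2 * (t * exp (4 * t))"
      by (simp add: power_mult_distrib power2_eq_square flip: exp_add)
    finally have "1 / (3 * E\<^sup>2 * (t * exp (4 * t))) \<le> 1 / ((real N)\<^sup>2 * ln N)"
      by (intro divide_left_mono mult_pos_pos) (use N65 ln0 E t1 in simp_all)
    then have "2 - 1 / ((real N)\<^sup>2 * ln N) \<le> 2 - (1 / (3 * E\<^sup>2)) / (t * exp (4 * t))" by simp
    then show ?thesis using dim by (meson ereal_less_eq(3) order_trans)
  qed
  moreover have "0 < 1 / (3 * E\<^sup>2)" using E by simp
  ultimately show ?thesis by (intro exI[of _ "1 / (3 * E\<^sup>2)"] exI[of _ "max 1 (ln E)"] conjI) auto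
qed

lemma dim_asymptotic_lower:
  assumes d: "d > 0"
  shows "\<exists>k0>0. \<exists>t0\<ge>1. \<forall>t\<ge>t0. (\<exists>z. approx_const d z = exp (- t)) \<and>
    ereal (1 - k0 / (t * exp (t / 2))) \<le> hausdorff_dim {z. approx_const d z = exp (- t)} \<and>
    ereal (2 - k0 / (t * exp t)) \<le> hausdorff_dim {z. exp (- t) \<le> approx_const d z}"
proof -
  define a where "a = sqrt (sep_const d) / 2"
  have "0 < sqrt (sep_const d)" "sqrt (sep_const d) \<le> 1"
    using sep_const_pos[OF d] sep_const_le_1[OF d] by simp_all
  then have a: "0 < a" "a \<le> 1" unfolding a_def by linarith+
  define T where "T = max 1 (max (2 * ln (484 / a)) (- 4 * ln (a / 2)))"
  define k0 where "k0 = 3872 / a\<^sup>2"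
  have k0: "0 < k0" using a by (simp add: k0_def)
  have "(\<exists>z. approx_const d z = exp (- t)) \<and>
      ereal (1 - k0 / (t * exp (t / 2))) \<le> hausdorff_dim {z. approx_const d z = exp (- t)} \<and>
      ereal (2 - k0 / (t * exp t)) \<le> hausdorff_dim {z. exp (- t) \<le> approx_const d z}" if t: "T \<le> t" for t
  proof -
    have t1: "1 \<le> t" "2 * ln (484 / a) \<le> t" "- 4 * ln (a / 2) \<le> t" using t by (auto simp: T_def)
    define y where "y = a * exp (t / 2)"
    have "484 / a = exp (ln (484 / a))" using a by simp
    also have "\<dots> \<le> exp (t / 2)" using t1(2) by simp
    finally have y484: "484 \<le> y" using a by (simp add: y_def field_simps)
    \<comment> \<open>the largest \<open>N\<close> with \<open>4 N\<^sup>2 exp (- t) \<le> sep_const d\<close>; the bound on \<open>t\<close> ensures \<open>N \<ge> 242\<close> and \<open>ln N \<ge> t / 4\<close>\<close>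
    define N where "N = nat \<lfloor>y\<rfloor>"
    have N: "N \<le> y" "y / 2 \<le> N" "242 \<le> N" using y484 unfolding N_def by linarith+
    have N0: "real N > 0" using N by simp
    have "4 * (real N)\<^sup>2 * exp (- t) \<le> 4 * y\<^sup>2 * exp (- t)"
      using N(1) by (intro mult_right_mono mult_left_mono power_mono) auto
    also have "4 * y\<^sup>2 * exp (- t) = 4 * a\<^sup>2"
    proof -
      have "(exp (t / 2))\<^sup>2 = exp t" by (simp add: power2_eq_square flip: exp_add)
      then show ?thesis by (simp add: y_def power_mult_distrib exp_minus)
    qed
    also have "\<dots> = sep_const d" using sep_const_pos[OF d] by (simp add: a_def power_divide)
    finally have c: "4 * (real N)\<^sup>2 * exp (- t) \<le> sep_const d" .
    have "t / 4 \<le> ln (a / 2) + t / 2" using t1(3) by simp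
    also have "\<dots> = ln (y / 2)" using a by (simp add: y_def ln_mult ln_div)
    also have "\<dots> \<le> ln N" using N(2) y484 by simp
    finally have lnN: "t / 4 \<le> ln N" .
    then have ln0: "0 < ln (real N)" using t1 by linarith
    have "k0 / (t * exp (t / 2)) \<ge> 242 / (N * ln N)"
    proof -
      have "(y / 2) * (t / 4) \<le> N * ln N" using N lnN t1 y484 by (intro mult_mono) auto
      then have "242 / (N * ln N) \<le> 242 / ((y / 2) * (t / 4))"
        using y484 t1 by (intro divide_left_mono mult_pos_pos N0 ln0) simp_all
      also have "\<dots> = (1936 / a) / (t * exp (t / 2))" by (simp add: y_def)
      also have "\<dots> \<le> k0 / (t * exp (t / 2))"
      proof (rule divide_right_mono)
        have "a * a \<le> 1 * a" using a by (intro mult_right_mono) auto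
        then show "1936 / a \<le> k0" unfolding k0_def using a by (intro frac_le) (auto simp: power2_eq_square)
      qed (use t1 in simp)
      finally show ?thesis .
    qed
    then have "1 - k0 / (t * exp (t / 2)) \<le> 1 - 242 / (N * ln N)" by simp
    then have 1: "ereal (1 - k0 / (t * exp (t / 2))) \<le> hausdorff_dim {z. approx_const d z = exp (- t)}"
      using level_dim_ge(1)[OF d _ c N(3)] by (meson ereal_less_eq(3) exp_gt_zero order_trans)
    have "k0 / (t * exp t) \<ge> 242 / ((real N)\<^sup>2 * ln N)"
    proof -
      have "(y / 2)\<^sup>2 * (t / 4) \<le> (real N)\<^sup>2 * ln N" using N lnN t1 y484 by (intro mult_mono power_mono) auto
      then have "242 / ((real N)\<^sup>2 * ln N) \<le> 242 / ((y / 2)\<^sup>2 * (t / 4))"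
        using y484 t1 by (intro divide_left_mono mult_pos_pos zero_less_power N0 ln0) simp_all
      also have "(y / 2)\<^sup>2 = a\<^sup>2 / 4 * exp t"
        by (simp add: y_def power_mult_distrib power_divide power2_eq_square flip: exp_add)
      also have "242 / (a\<^sup>2 / 4 * exp t * (t / 4)) = k0 / (t * exp t)" by (simp add: k0_def)
      finally show ?thesis .
    qed
    then have "2 - k0 / (t * exp t) \<le> 2 - 242 / ((real N)\<^sup>2 * ln N)" by simp
    then have 2: "ereal (2 - k0 / (t * exp t)) \<le> hausdorff_dim {z. exp (- t) \<le> approx_const d z}"
      using sublevel_dim_ge[OF d _ c N(3)] by (meson ereal_less_eq(3) exp_gt_zero order_trans)
    show ?thesis using 1 2 level_dim_ge(2)[OF d _ c N(3)] by simp
  qed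
  moreover have "1 \<le> T" by (simp add: T_def)
  ultimately show ?thesis using k0 by blast
qed

text \<open>A level set is contained in the corresponding sublevel set, so one upper bound serves both.\<close>

lemma dimension_asymptotics:
  assumes d: "d > 0"
  shows "\<exists>t0 t1 k0 ku :: real. {t0..} \<subseteq> spectrum d \<and> k0 > 0 \<and> ku > 0 \<and>
          (\<forall>t \<ge> t0. ereal (1 - k0 / (t * exp (t / 2))) \<le> dim_level d t \<and>
                    dim_level d t \<le> ereal (2 - ku / (t * exp (4 * t)))) \<and>
          (\<forall>t \<in> spectrum d. t \<ge> t1 \<longrightarrow>
                    ereal (2 - k0 / (t * exp t)) \<le> dim_sublevel d t \<and>
                    dim_sublevel d t \<le> ereal (2 - ku / (t * exp (4 * t))))"
proof -
  obtain ku tu where u: "ku > 0" "\<And>t. tu \<le> t \<Longrightarrow>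
      hausdorff_dim {z. exp (- t) \<le> approx_const d z} \<le> ereal (2 - ku / (t * exp (4 * t)))"
    using sublevel_dim_asymptotic_upper[OF d] by blast
  obtain k0 tl where l: "k0 > 0" "\<And>t. tl \<le> t \<Longrightarrow> \<exists>z. approx_const d z = exp (- t)"
      "\<And>t. tl \<le> t \<Longrightarrow> ereal (1 - k0 / (t * exp (t / 2))) \<le> hausdorff_dim {z. approx_const d z = exp (- t)}"
      "\<And>t. tl \<le> t \<Longrightarrow> ereal (2 - k0 / (t * exp t)) \<le> hausdorff_dim {z. exp (- t) \<le> approx_const d z}"
    using dim_asymptotic_lower[OF d] by metis
  have sub: "dim_level d t \<le> dim_sublevel d t" for t
    unfolding dim_level_def dim_sublevel_def by (rule hausdorff_dim_mono) auto
  have "{max tl tu..} \<subseteq> spectrum d"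
  proof
    fix t assume "t \<in> {max tl tu..}"
    then obtain z where "approx_const d z = exp (- t)" using l(2) by auto
    then have "z \<in> Bad d" "t = - ln (approx_const d z)" by (simp_all add: Bad_def)
    then show "t \<in> spectrum d" unfolding spectrum_def by blast
  qed
  moreover have "ereal (1 - k0 / (t * exp (t / 2))) \<le> dim_level d t" if "max tl tu \<le> t" for t
    using l(3) that unfolding dim_level_def level_eq by simp
  moreover have lower: "ereal (2 - k0 / (t * exp t)) \<le> dim_sublevel d t" if "max tl tu \<le> t" for t
    using l(4) that unfolding dim_sublevel_def sublevel_eq by simp
  moreover have upper: "dim_sublevel d t \<le> ereal (2 - ku / (t * exp (4 * t)))" if "max tl tu \<le> t" for t
    using u(2) that unfolding dim_sublevel_def sublevel_eq by simp
  moreover have "dim_level d t \<le> ereal (2 - ku / (t * exp (4 * t)))" if "max tl tu \<le> t" for t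
    using sub upper[OF that] by (rule order_trans)
  ultimately show ?thesis using u(1) l(1) by blast
qed

theorem theorem1p10:
  shows "\<exists>\<beta>s :: complex set \<Rightarrow> real. (\<forall>X. \<beta>s X > 0) \<and>
    (\<forall>d \<in> {1, 2, 3, 7, 11, 19, 43, 67, 163 :: nat}.
       absolute_winning (\<beta>s UNIV) UNIV (Bad d) \<and>
       (\<forall>p \<in> \<O> d. \<forall>q \<in> \<O> d. \<forall>r :: real. q \<noteq> 0 \<and> 0 < r \<and> r \<le> 1 / (2 * (cmod q)\<^sup>2) \<longrightarrow>
          absolute_winning (\<beta>s (sphere (p / q) r)) (sphere (p / q) r) (Bad d \<inter> sphere (p / q) r)) \<and>
       (\<exists>t0 t1 k0 ku :: real. {t0..} \<subseteq> spectrum d \<and> k0 > 0 \<and> ku > 0 \<and>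
          (\<forall>t \<ge> t0. ereal (1 - k0 / (t * exp (t / 2))) \<le> dim_level d t \<and>
                    dim_level d t \<le> ereal (2 - ku / (t * exp (4 * t)))) \<and>
          (\<forall>t \<in> spectrum d. t \<ge> t1 \<longrightarrow>
                    ereal (2 - k0 / (t * exp t)) \<le> dim_sublevel d t \<and>
                    dim_sublevel d t \<le> ereal (2 - ku / (t * exp (4 * t))))))"
proof (intro exI[of _ "\<lambda>_. 1 / 10"] conjI allI ballI impI)
  fix d :: nat assume "d \<in> {1, 2, 3, 7, 11, 19, 43, 67, 163}"
  then have d: "d > 0" by auto
  show "absolute_winning (1 / 10) UNIV (Bad d)" by (rule Bad_absolute_winning_plane[OF d])
  show "absolute_winning (1 / 10) (sphere (p / q) r) (Bad d \<inter> sphere (p / q) r)"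
    if "q \<noteq> 0 \<and> 0 < r \<and> r \<le> 1 / (2 * (cmod q)\<^sup>2)" for p q r
    using that by (intro Bad_absolute_winning_circle d) simp
next
  fix d :: nat assume "d \<in> {1, 2, 3, 7, 11, 19, 43, 67, 163}"
  then have "d > 0" by auto
  then show "\<exists>t0 t1 k0 ku :: real. {t0..} \<subseteq> spectrum d \<and> k0 > 0 \<and> ku > 0 \<and>
          (\<forall>t \<ge> t0. ereal (1 - k0 / (t * exp (t / 2))) \<le> dim_level d t \<and>
                    dim_level d t \<le> ereal (2 - ku / (t * exp (4 * t)))) \<and>
          (\<forall>t \<in> spectrum d. t \<ge> t1 \<longrightarrow>
                    ereal (2 - k0 / (t * exp t)) \<le> dim_sublevel d t \<and>
                    dim_sublevel d t \<le> ereal (2 - ku / (t * exp (4 * t))))"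
    by (rule dimension_asymptotics)
qed simp

end
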